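(* Let $\mathbf{G}_N$ be the $N\times N$ complex Ginibre matrix, let $\sigma\in(0,1)$ and an integer $k\ge0$ be fixed, and for each $N$ let $\mathbf{b}_N\in\mathbb{C}^N$ be a nonzero random vector, possibly depending on $\mathbf{G}_N$. Then the step $k$ GMRES residual norm $\|\mathbf{r}_N^{(k)}\|$ for the linear system $(\mathbf{I}+\sigma\mathbf{G}_N)\mathbf{x}=\mathbf{b}_N$ satisfies $$\frac{\|\mathbf{r}_N^{(k)}\|}{\|\mathbf{b}_N\|}\lesssim\inf_{\eta>1}\ \eta\,\mathfrak{e}(\eta)^{-1/2}(\sigma\eta)^k\qquad\text{and}\qquad\frac{\|\mathbf{r}_N^{(k)}\|}{\|\mathbf{b}_N\|}\lesssim 2(\sqrt{2}\,\sigma)^k$$ almost surely as $N\to\infty$.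
   Context: Ginibre matrix: $\mathbf{G}_N=\frac{1}{\sqrt{2N}}(\mathbf{X}_N+\mathrm{i}\,\mathbf{Y}_N)$, where $\mathbf{X}_N,\mathbf{Y}_N$ are independent $N\times N$ matrices with i.i.d. real standard Gaussian entries. All $N$ are treated on one probability space: $\mathbf{X}_N$ and $\mathbf{Y}_N$ are the leading $N\times N$ principal blocks of fixed infinite arrays of i.i.d. standard Gaussians. GMRES residual norm: for $\mathbf{A}\in\mathbb{C}^{N\times N}$ and $\mathbf{b}\in\mathbb{C}^N$, the step $k$ GMRES residual norm for $\mathbf{A}\mathbf{x}=\mathbf{b}$ is $$\|\mathbf{r}^{(k)}\|=\min_{\deg(p)\le k,\ p(0)=1}\|p(\mathbf{A})\mathbf{b}\|,$$ where the minimum is over complex polynomials $p$ and $\|\cdot\|$ is the Euclidean norm. The function $\mathfrak{e}:[1,\infty)\to[0,\infty)$ is the increasing function, with $\mathfrak{e}(1)=0$, defined by $$\mathfrak{e}(z)=\frac{8d^2-(9-8d)^{3/2}-36d+27}{8(1-d)},\qquad d=1-|z|^2.$$ For random variables $X_N$ and a constant $c\in\mathbb{R}$, "$X_N\lesssim c$ almost surely as $N\to\infty$" means: for every $\epsilon>0$, the indicator $\mathbf{1}[X_N<c+\epsilon]$ converges to $1$ almost surely as $N\to\infty$. *)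

theory Defs
  imports
    "HOL-Probability.Probability"
    "HOL-Computational_Algebra.Polynomial"
    "Jordan_Normal_Form.Matrix"
begin

definition vec_l2_norm :: "complex vec \<Rightarrow> real" where
  "vec_l2_norm v = L2_set (\<lambda>i. cmod (v $ i)) {..<dim_vec v}"

text \<open>The value \<open>p(A)\<close> of a polynomial at a square matrix, \<open>\<Sum>\<^sub>l p\<^sub>l A\<^sup>l\<close>, is written entrywise, since
  matrices of variable dimension do not form an additive monoid on the whole type.\<close>

definition poly_of_mat :: "complex poly \<Rightarrow> complex mat \<Rightarrow> complex mat" where
  "poly_of_mat p A = mat (dim_row A) (dim_row A)
     (\<lambda>(i, j). \<Sum>l\<le>degree p. coeff p l * (A ^\<^sub>m l) $$ (i, j))"

text \<open>The infimum below is a minimum; see \<open>gmres_residual_attained\<close>.\<close>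

definition gmres_residual :: "complex mat \<Rightarrow> complex vec \<Rightarrow> nat \<Rightarrow> real" where
  "gmres_residual A b k =
     (INF p\<in>{p :: complex poly. degree p \<le> k \<and> poly p 0 = 1}. vec_l2_norm (poly_of_mat p A *\<^sub>v b))"

text \<open>Meant for \<open>z \<ge> 1\<close>. There \<open>d \<le> 0\<close>, so that the base of \<open>powr\<close> is positive and the denominator
  does not vanish.\<close>

definition frak_e :: "real \<Rightarrow> real" where
  "frak_e z = (let d = 1 - \<bar>z\<bar>\<^sup>2 in
     (8 * d\<^sup>2 - (9 - 8 * d) powr (3 / 2) - 36 * d + 27) / (8 * (1 - d)))"

text \<open>Two infinite arrays whose entries form, taken all together, one i.i.d. standard Gaussian family.
  The Boolean component of the index selects the array.\<close>

definition gaussian_arrays ::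
  "'w measure \<Rightarrow> (nat \<Rightarrow> nat \<Rightarrow> 'w \<Rightarrow> real) \<Rightarrow> (nat \<Rightarrow> nat \<Rightarrow> 'w \<Rightarrow> real) \<Rightarrow> bool" where
  "gaussian_arrays M X Y \<longleftrightarrow>
     prob_space.indep_vars M (\<lambda>_. borel)
       (\<lambda>(first, i, j). if first then X i j else Y i j) (UNIV :: (bool \<times> nat \<times> nat) set) \<and>
     (\<forall>i j. distributed M lborel (X i j) std_normal_density) \<and>
     (\<forall>i j. distributed M lborel (Y i j) std_normal_density)"

definition ginibre ::
  "(nat \<Rightarrow> nat \<Rightarrow> 'w \<Rightarrow> real) \<Rightarrow> (nat \<Rightarrow> nat \<Rightarrow> 'w \<Rightarrow> real) \<Rightarrow> nat \<Rightarrow> 'w \<Rightarrow> complex mat" where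
  "ginibre X Y N \<omega> = complex_of_real (1 / sqrt (2 * real N)) \<cdot>\<^sub>m
     mat N N (\<lambda>(i, j). complex_of_real (X i j \<omega>) + \<i> * complex_of_real (Y i j \<omega>))"

definition lesssim_almost_surely :: "'w measure \<Rightarrow> (nat \<Rightarrow> 'w \<Rightarrow> real) \<Rightarrow> real \<Rightarrow> bool" where
  "lesssim_almost_surely M Z c \<longleftrightarrow>
     (\<forall>\<epsilon>>0. AE \<omega> in M. (\<lambda>N. indicator {\<omega>. Z N \<omega> < c + \<epsilon>} \<omega> :: real) \<longlonglongrightarrow> 1)"


lemma orthogonal_residual_exists:
  fixes v :: "nat \<Rightarrow> nat \<Rightarrow> complex" and n m :: nat
  shows "\<exists>c. \<forall>j<m. (\<Sum>i<n. (b i + (\<Sum>l<m. c l * v l i)) * cnj (v j i)) = 0"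
proof (induction m arbitrary: b)
  case 0
  then show ?case by simp
next
  case (Suc m)
  obtain c where c: "\<And>j. j < m \<Longrightarrow> (\<Sum>i<n. (b i + (\<Sum>l<m. c l * v l i)) * cnj (v j i)) = 0"
    using Suc[of b] by blast
  obtain a where a: "\<And>j. j < m \<Longrightarrow> (\<Sum>i<n. (v m i + (\<Sum>l<m. a l * v l i)) * cnj (v j i)) = 0"
    using Suc[of "v m"] by blast
  define r where "r i = b i + (\<Sum>l<m. c l * v l i)" for i
  define w where "w i = v m i + (\<Sum>l<m. a l * v l i)" for i
  define W where "W = (\<Sum>i<n. w i * cnj (w i))"
  define t where "t = (if W = 0 then 0 else - (\<Sum>i<n. r i * cnj (w i)) / W)"
  define q where "q i = r i + t * w i" for i
  have q_low: "(\<Sum>i<n. q i * cnj (v j i)) = 0" if "j < m" for j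
  proof -
    have "(\<Sum>i<n. q i * cnj (v j i)) = (\<Sum>i<n. r i * cnj (v j i)) + t * (\<Sum>i<n. w i * cnj (v j i))"
      by (simp add: q_def ring_distribs sum.distrib sum_distrib_left mult.assoc)
    then show ?thesis using c[OF that] a[OF that] by (simp add: r_def w_def)
  qed
  have W_real: "W = of_real (\<Sum>i<n. (cmod (w i))\<^sup>2)"
    by (simp add: W_def complex_norm_square[symmetric])
  have w0: "w i = 0" if "W = 0" "i < n" for i
  proof -
    have "(\<Sum>i<n. (cmod (w i))\<^sup>2) = 0" using that(1) W_real by (metis of_real_eq_0_iff)
    then show ?thesis using that(2) by (simp add: sum_nonneg_eq_0_iff)
  qed
  have q_w: "(\<Sum>i<n. q i * cnj (w i)) = 0"
  proof (cases "W = 0")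
    case True
    then show ?thesis using w0 by simp
  next
    case False
    have "(\<Sum>i<n. q i * cnj (w i)) = (\<Sum>i<n. r i * cnj (w i)) + t * W"
      by (simp add: q_def W_def ring_distribs sum.distrib sum_distrib_left mult.assoc)
    then show ?thesis using False by (simp add: t_def)
  qed
  have q_m: "(\<Sum>i<n. q i * cnj (v m i)) = 0"
  proof -
    have "(\<Sum>i<n. q i * cnj (w i))
        = (\<Sum>i<n. q i * cnj (v m i)) + (\<Sum>i<n. \<Sum>l<m. cnj (a l) * (q i * cnj (v l i)))"
      by (simp add: w_def ring_distribs sum.distrib sum_distrib_left mult_ac)
    also have "(\<Sum>i<n. \<Sum>l<m. cnj (a l) * (q i * cnj (v l i)))
        = (\<Sum>l<m. cnj (a l) * (\<Sum>i<n. q i * cnj (v l i)))"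
      by (subst sum.swap) (simp add: sum_distrib_left)
    also have "\<dots> = 0" using q_low by simp
    finally show ?thesis using q_w by simp
  qed
  define c' where "c' l = (if l = m then t else c l + t * a l)" for l
  have "(\<Sum>l<Suc m. c' l * v l i) = (\<Sum>l<m. c l * v l i) + t * w i" for i
    by (simp add: c'_def w_def ring_distribs sum.distrib sum_distrib_left mult.assoc)
  then have "q i = b i + (\<Sum>l<Suc m. c' l * v l i)" for i
    by (simp add: q_def r_def)
  then have "\<forall>j<Suc m. (\<Sum>i<n. (b i + (\<Sum>l<Suc m. c' l * v l i)) * cnj (v j i)) = 0"
    using q_low q_m by (simp add: less_Suc_eq del: sum.lessThan_Suc)
  then show ?case by blast
qed

lemma least_squares_attained:
  fixes v :: "nat \<Rightarrow> nat \<Rightarrow> complex" and n m :: nat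
  shows "\<exists>c. \<forall>c'. L2_set (\<lambda>i. cmod (b i + (\<Sum>l<m. c l * v l i))) {..<n}
                 \<le> L2_set (\<lambda>i. cmod (b i + (\<Sum>l<m. c' l * v l i))) {..<n}"
proof -
  obtain c where c: "\<And>j. j < m \<Longrightarrow> (\<Sum>i<n. (b i + (\<Sum>l<m. c l * v l i)) * cnj (v j i)) = 0"
    using orthogonal_residual_exists[where b = b and v = v and n = n and m = m] by blast
  define r where "r i = b i + (\<Sum>l<m. c l * v l i)" for i
  have "L2_set (\<lambda>i. cmod (r i)) {..<n}
      \<le> L2_set (\<lambda>i. cmod (b i + (\<Sum>l<m. c' l * v l i))) {..<n}" for c'
  proof -
    define u where "u i = (\<Sum>l<m. (c' l - c l) * v l i)" for i
    have split: "b i + (\<Sum>l<m. c' l * v l i) = r i + u i" for i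
      by (simp add: r_def u_def ring_distribs sum_subtractf)
    have "(\<Sum>i<n. r i * cnj (u i)) = (\<Sum>i<n. \<Sum>l<m. cnj (c' l - c l) * (r i * cnj (v l i)))"
      by (simp add: u_def sum_distrib_left mult_ac)
    also have "\<dots> = (\<Sum>l<m. cnj (c' l - c l) * (\<Sum>i<n. r i * cnj (v l i)))"
      by (subst sum.swap) (simp add: sum_distrib_left)
    also have "\<dots> = 0" using c by (simp add: r_def)
    finally have orth: "(\<Sum>i<n. Re (r i * cnj (u i))) = 0"
      by (metis Re_sum zero_complex.simps(1))
    have "(cmod (r i + u i))\<^sup>2 = (cmod (r i))\<^sup>2 + 2 * Re (r i * cnj (u i)) + (cmod (u i))\<^sup>2" for i
      unfolding cmod_power2 by (simp add: power2_eq_square algebra_simps)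
    then have "(\<Sum>i<n. (cmod (r i + u i))\<^sup>2)
        = (\<Sum>i<n. (cmod (r i))\<^sup>2) + 2 * (\<Sum>i<n. Re (r i * cnj (u i))) + (\<Sum>i<n. (cmod (u i))\<^sup>2)"
      by (simp add: sum.distrib sum_distrib_left)
    also have "\<dots> \<ge> (\<Sum>i<n. (cmod (r i))\<^sup>2)"
      unfolding orth by (simp add: sum_nonneg)
    finally show ?thesis by (simp add: L2_set_def split)
  qed
  then show ?thesis unfolding r_def by blast
qed

lemma poly_of_mat_mult_vec:
  assumes A: "A \<in> carrier_mat n n" and b: "b \<in> carrier_vec n"
    and p: "degree p \<le> k" "poly p 0 = 1" and i: "i < n"
  shows "(poly_of_mat p A *\<^sub>v b) $ i
       = b $ i + (\<Sum>l<k. coeff p (Suc l) * ((A ^\<^sub>m Suc l) *\<^sub>v b) $ i)"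
proof -
  have pow: "A ^\<^sub>m l \<in> carrier_mat n n" for l using A by simp
  have dims: "dim_row (A ^\<^sub>m l) = n" "dim_col (A ^\<^sub>m l) = n" "dim_vec b = n" for l
    using pow[of l] b by auto
  have pv: "(A ^\<^sub>m l *\<^sub>v b) $ i = (\<Sum>j<n. (A ^\<^sub>m l) $$ (i, j) * b $ j)" for l
    using i dims by (simp add: scalar_prod_def atLeast0LessThan row_def del: pow_mat.simps)
  have "(poly_of_mat p A *\<^sub>v b) $ i
      = (\<Sum>j<n. (\<Sum>l\<le>degree p. coeff p l * (A ^\<^sub>m l) $$ (i, j)) * b $ j)"
    using A b i by (simp add: poly_of_mat_def scalar_prod_def atLeast0LessThan)
  also have "\<dots> = (\<Sum>l\<le>degree p. coeff p l * (\<Sum>j<n. (A ^\<^sub>m l) $$ (i, j) * b $ j))"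
    unfolding sum_distrib_right sum_distrib_left by (subst sum.swap) (simp add: mult.assoc)
  also have "\<dots> = (\<Sum>l\<le>degree p. coeff p l * (A ^\<^sub>m l *\<^sub>v b) $ i)"
    by (simp only: pv)
  also have "\<dots> = (\<Sum>l\<le>k. coeff p l * (A ^\<^sub>m l *\<^sub>v b) $ i)"
    using p(1) by (intro sum.mono_neutral_left) (auto simp: coeff_eq_0)
  also have "\<dots> = coeff p 0 * (A ^\<^sub>m 0 *\<^sub>v b) $ i
                + (\<Sum>l<k. coeff p (Suc l) * ((A ^\<^sub>m Suc l) *\<^sub>v b) $ i)"
    by (rule sum.atMost_shift)
  also have "coeff p 0 = 1" using p(2) by (simp add: poly_0_coeff_0)
  also have "(A ^\<^sub>m 0 *\<^sub>v b) $ i = b $ i" using A b by simp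
  finally show ?thesis by simp
qed

lemma gmres_residual_attained:
  assumes A: "A \<in> carrier_mat n n" and b: "b \<in> carrier_vec n"
  shows "\<exists>p. degree p \<le> k \<and> poly p 0 = 1 \<and> gmres_residual A b k = vec_l2_norm (poly_of_mat p A *\<^sub>v b)
           \<and> (\<forall>q. degree q \<le> k \<and> poly q 0 = 1 \<longrightarrow>
                vec_l2_norm (poly_of_mat p A *\<^sub>v b) \<le> vec_l2_norm (poly_of_mat q A *\<^sub>v b))"
proof -
  define v where "v l i = ((A ^\<^sub>m Suc l) *\<^sub>v b) $ i" for l i
  have nrm: "vec_l2_norm (poly_of_mat p A *\<^sub>v b)
      = L2_set (\<lambda>i. cmod (b $ i + (\<Sum>l<k. coeff p (Suc l) * v l i))) {..<n}"
    if "degree p \<le> k" "poly p 0 = 1" for p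
  proof -
    have "dim_vec (poly_of_mat p A *\<^sub>v b) = n" using A by (simp add: poly_of_mat_def)
    then show ?thesis
      using poly_of_mat_mult_vec[OF A b that]
      unfolding vec_l2_norm_def v_def by (intro L2_set_cong) auto
  qed
  obtain c where c: "\<And>c'. L2_set (\<lambda>i. cmod (b $ i + (\<Sum>l<k. c l * v l i))) {..<n}
                 \<le> L2_set (\<lambda>i. cmod (b $ i + (\<Sum>l<k. c' l * v l i))) {..<n}"
    using least_squares_attained[where b = "\<lambda>i. b $ i" and v = v and n = n and m = k] by blast
  define p where "p = pCons 1 (\<Sum>l<k. monom (c l) l)"
  have deg: "degree p \<le> k"
  proof (cases k)
    case 0
    then show ?thesis by (simp add: p_def)
  next
    case (Suc k')
    have "degree (\<Sum>l<k. monom (c l) l) \<le> k'"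
      using Suc by (intro degree_sum_le) (auto intro: order_trans[OF degree_monom_le])
    then show ?thesis using Suc by (simp add: p_def degree_pCons_eq_if)
  qed
  have p0: "poly p 0 = 1" by (simp add: p_def)
  have "coeff p (Suc l) = c l" if "l < k" for l
    using that by (simp add: p_def coeff_sum)
  then have np: "vec_l2_norm (poly_of_mat p A *\<^sub>v b)
      = L2_set (\<lambda>i. cmod (b $ i + (\<Sum>l<k. c l * v l i))) {..<n}"
    using nrm[OF deg p0] by simp
  have min: "vec_l2_norm (poly_of_mat p A *\<^sub>v b) \<le> vec_l2_norm (poly_of_mat q A *\<^sub>v b)"
    if "degree q \<le> k" "poly q 0 = 1" for q
    unfolding np nrm[OF that] by (rule c)
  have "gmres_residual A b k = vec_l2_norm (poly_of_mat p A *\<^sub>v b)"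
    unfolding gmres_residual_def
    by (rule cInf_eq_minimum) (use deg p0 min in auto)
  then show ?thesis using deg p0 min by blast
qed

end

theory Submission
  imports Defs "HOL-Library.Function_Algebras" "HOL-Real_Asymp.Real_Asymp"
begin

text \<open>Taking \<open>p(z) = (1 - z)\<^sup>k\<close> bounds the residual ratio by \<open>\<sigma>\<^sup>k \<parallel>G\<^sup>k\<parallel>\<close>, and both stated constants dominate
  \<open>\<sigma>\<^sup>k (k + 1)\<close>; so it suffices that \<open>limsup \<parallel>G\<^sup>k\<parallel> \<le> k + 1\<close> almost surely.

  In the Hermite basis, multiplication by a standard Gaussian is a creation plus an annihilation operator
  on Fock space, whence \<open>G = A + B\<close>, where \<open>A\<close> and \<open>B\<close> are matrices of complex creation and annihilation
  operators divided by \<open>sqrt N\<close>. By the canonical commutation relations and the bound on the number operator,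
  on states of degree at most \<open>n\<close> both \<open>A\<close> and \<open>B\<close> have norm at most \<open>sqrt (1 + n / N)\<close>, while \<open>B A\<close> has norm at most
  \<open>n / N\<close>. Expanding \<open>(A + B)\<^sup>k\<close> and discarding words that contain \<open>B A\<close> leaves \<open>\<Sum>\<^sub>j A\<^sup>j B\<^bsup>k-j\<^esup>\<close>, so \<open>G\<^sup>k\<close> acts with
  norm at most \<open>k + 1 + o(1)\<close> as long as \<open>n = o(N)\<close>. Hence the expected trace of \<open>((G\<^sup>k)\<^sup>* G\<^sup>k)\<^sup>m\<close>, a vacuum expectation, is at
  most \<open>N (k + 1 + o(1))\<^bsup>2m\<^esup>\<close>; with \<open>m\<close> of order \<open>sqrt N\<close>, Markov's inequality and Borel--Cantelli conclude.\<close>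

section \<open>Creation and annihilation operators\<close>

text \<open>A Fock vector is given by its coefficients in the occupation-number basis, the occupation numbers being
  the multiplicities of a multiset. The Boolean component of a mode selects the array \<open>X\<close> or \<open>Y\<close>.\<close>

type_synonym site = "nat \<times> nat"
type_synonym fock = "(bool \<times> site) multiset \<Rightarrow> complex"

definition annih :: "bool \<times> site \<Rightarrow> fock \<Rightarrow> fock" where
  "annih p \<psi> = (\<lambda>\<alpha>. complex_of_real (sqrt (real (count \<alpha> p + 1))) * \<psi> (add_mset p \<alpha>))"

definition creat :: "bool \<times> site \<Rightarrow> fock \<Rightarrow> fock" where
  "creat p \<psi> = (\<lambda>\<alpha>. complex_of_real (sqrt (real (count \<alpha> p))) * \<psi> (\<alpha> - {#p#}))"

text \<open>These belong to the complex Gaussian \<open>(X + e Y) / sqrt 2\<close>, with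
  \<open>e\<close> later \<open>\<i>\<close> or \<open>- \<i>\<close>. Creation and annihilation
  carry the same \<open>e\<close>, so that their sum is multiplication by this Gaussian; hence the
  adjoint of \<open>cannih e u\<close> is \<open>ccreat (cnj e) u\<close>.\<close>

definition cannih :: "complex \<Rightarrow> site \<Rightarrow> fock \<Rightarrow> fock" where
  "cannih e u \<psi> = (\<lambda>\<alpha>. (annih (True, u) \<psi> \<alpha> + e * annih (False, u) \<psi> \<alpha>) / complex_of_real (sqrt 2))"

definition ccreat :: "complex \<Rightarrow> site \<Rightarrow> fock \<Rightarrow> fock" where
  "ccreat e u \<psi> = (\<lambda>\<alpha>. (creat (True, u) \<psi> \<alpha> + e * creat (False, u) \<psi> \<alpha>) / complex_of_real (sqrt 2))"

lemma creat_annih: "creat p (annih p \<psi>) \<alpha> = of_nat (count \<alpha> p) * \<psi> \<alpha>"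
proof (cases "p \<in># \<alpha>")
  case True
  then obtain \<beta> where "\<alpha> = add_mset p \<beta>" by (metis multi_member_split)
  then show ?thesis
    unfolding annih_def creat_def by (simp add: mult.assoc[symmetric] flip: of_real_mult)
qed (simp add: creat_def not_in_iff)

text \<open>The canonical commutation relation. For equal modes the two orders count
  \<open>count \<alpha> p + 1\<close> and \<open>count \<alpha> p\<close>; distinct modes act on
  independent multiplicities. If \<open>q\<close> is absent from \<open>\<alpha>\<close>, the factor
  \<open>sqrt 0\<close> removes the truncated difference.\<close>

lemma annih_creat:
  "annih p (creat q \<psi>) \<alpha> = creat q (annih p \<psi>) \<alpha> + (if p = q then \<psi> \<alpha> else 0)"
proof (cases "p = q")
  case True
  have sq: "complex_of_real (sqrt (real n)) * (complex_of_real (sqrt (real n)) * z) = of_nat n * z" for n z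
    by (simp flip: of_real_mult add: mult.assoc[symmetric])
  have "annih p (creat p \<psi>) \<alpha> = of_nat (count \<alpha> p + 1) * \<psi> \<alpha>"
    unfolding annih_def creat_def using sq[of "count \<alpha> p + 1" "\<psi> \<alpha>"] by simp
  then show ?thesis using True by (simp add: creat_annih ring_distribs)
next
  case False
  have "q \<in># \<alpha> \<or> count \<alpha> q = 0" by (simp add: count_eq_zero_iff)
  then show ?thesis
    using False by (auto simp: annih_def creat_def algebra_simps dest!: multi_member_split)
qed

text \<open>At equal sites the commutator \<open>(1 + e * d) / 2\<close> is 0 when
  \<open>d = e\<close> is \<open>\<i>\<close> or \<open>- \<i>\<close>, and 1 when \<open>d\<close>
  has modulus one and \<open>e\<close> is its conjugate. The first case makes \<open>down\<close>
  after \<open>up\<close> small, the second governs the norm of \<open>up\<close>.\<close>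

lemma cannih_ccreat:
  "cannih e u (ccreat d v \<psi>) \<alpha>
   = ccreat d v (cannih e u \<psi>) \<alpha> + (if u = v then (1 + e * d) / 2 * \<psi> \<alpha> else 0)"
proof -
  have lin1: "annih p (\<lambda>\<alpha>. (\<psi>1 \<alpha> + d * \<psi>2 \<alpha>) / complex_of_real (sqrt 2)) \<alpha>
      = (annih p \<psi>1 \<alpha> + d * annih p \<psi>2 \<alpha>) / complex_of_real (sqrt 2)" for p \<psi>1 \<psi>2
    by (simp add: annih_def field_simps)
  have lin2: "creat p (\<lambda>\<alpha>. (\<psi>1 \<alpha> + e * \<psi>2 \<alpha>) / complex_of_real (sqrt 2)) \<alpha>
      = (creat p \<psi>1 \<alpha> + e * creat p \<psi>2 \<alpha>) / complex_of_real (sqrt 2)" for p \<psi>1 \<psi>2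
    by (simp add: creat_def field_simps)
  have 2: "complex_of_real (sqrt 2) * complex_of_real (sqrt 2) = 2"
    by (simp flip: of_real_mult)
  show ?thesis
    unfolding cannih_def ccreat_def lin1 lin2 annih_creat
    by (simp add: field_simps 2)
qed

section \<open>Fock space over the matrix positions, truncated at degree \<open>D\<close>\<close>

locale fock_space =
  fixes N D :: nat
  assumes N_pos: "0 < N"
begin

definition sites :: "site set" where
  "sites = {..<N} \<times> {..<N}"

definition states :: "nat \<Rightarrow> (bool \<times> site) multiset set" where
  "states n = {\<alpha>. set_mset \<alpha> \<subseteq> UNIV \<times> sites \<and> size \<alpha> \<le> n}"

definition deg_le :: "nat \<Rightarrow> fock \<Rightarrow> bool" where
  "deg_le n \<psi> \<longleftrightarrow> (\<forall>\<alpha>. \<alpha> \<notin> states n \<longrightarrow> \<psi> \<alpha> = 0)"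

text \<open>Summing over \<open>states D\<close> only keeps everything finite. The adjoint relations
  are exact for vectors below the cutoff, whence the degree hypotheses in what follows.\<close>

definition inner :: "fock \<Rightarrow> fock \<Rightarrow> complex" where
  "inner \<psi> \<phi> = (\<Sum>\<alpha>\<in>states D. \<psi> \<alpha> * cnj (\<phi> \<alpha>))"

definition norm_sq :: "fock \<Rightarrow> real" where
  "norm_sq \<psi> = (\<Sum>\<alpha>\<in>states D. (cmod (\<psi> \<alpha>))\<^sup>2)"

lemma finite_sites [simp]: "finite sites"
  by (simp add: sites_def)

lemma finite_states [simp]: "finite (states n)"
proof -
  have "states n \<subseteq> mset ` {xs. set xs \<subseteq> UNIV \<times> sites \<and> length xs \<le> n}"
  proof
    fix \<alpha> assume "\<alpha> \<in> states n"
    moreover obtain xs where "mset xs = \<alpha>" using ex_mset by blast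
    ultimately show "\<alpha> \<in> mset ` {xs. set xs \<subseteq> UNIV \<times> sites \<and> length xs \<le> n}"
      by (auto simp: states_def)
  qed
  moreover have "finite {xs. set xs \<subseteq> (UNIV :: bool set) \<times> sites \<and> length xs \<le> n}"
    by (rule finite_lists_length_le) simp
  ultimately show ?thesis by (meson finite_imageI finite_subset)
qed

lemma states_add_mset: "add_mset p \<alpha> \<in> states n \<longleftrightarrow> snd p \<in> sites \<and> \<alpha> \<in> states n \<and> size \<alpha> < n"
  by (cases p) (auto simp: states_def)

lemma deg_le_mono: "deg_le m \<psi> \<Longrightarrow> m \<le> n \<Longrightarrow> deg_le n \<psi>"
  by (fastforce simp: deg_le_def states_def)

lemma deg_le_annih: "deg_le n \<psi> \<Longrightarrow> deg_le n (annih p \<psi>)"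
  by (simp add: deg_le_def annih_def states_add_mset)

lemma deg_le_creat:
  assumes "deg_le n \<psi>" "snd p \<in> sites"
  shows "deg_le (Suc n) (creat p \<psi>)"
  unfolding deg_le_def
proof (intro allI impI)
  fix \<alpha> assume *: "\<alpha> \<notin> states (Suc n)"
  show "creat p \<psi> \<alpha> = 0"
  proof (cases "p \<in># \<alpha>")
    case True
    then obtain \<beta> where "\<alpha> = add_mset p \<beta>" by (metis multi_member_split)
    then show ?thesis using * assms by (cases p) (auto simp: creat_def deg_le_def states_def)
  qed (simp add: creat_def not_in_iff)
qed

lemma deg_le_cannih: "deg_le n \<psi> \<Longrightarrow> deg_le n (cannih e u \<psi>)"
  using deg_le_annih[of n \<psi> "(True, u)"] deg_le_annih[of n \<psi> "(False, u)"]
  by (simp add: deg_le_def cannih_def)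

lemma deg_le_ccreat: "deg_le n \<psi> \<Longrightarrow> u \<in> sites \<Longrightarrow> deg_le (Suc n) (ccreat e u \<psi>)"
  using deg_le_creat[of n \<psi> "(True, u)"] deg_le_creat[of n \<psi> "(False, u)"]
  by (simp add: deg_le_def ccreat_def)

text \<open>Adjointness is a reindexing by \<open>add_mset p\<close>. The cutoff spoils the
  bijection only at size \<open>D\<close>, where \<open>top\<close> makes the summand vanish. The
  form is bilinear, without conjugation, so that it serves both inner products and Hermite
  expansions.\<close>

lemma sum_annih_shift:
  fixes v :: fock
  assumes p: "snd p \<in> sites"
    and top: "\<And>\<alpha>. size \<alpha> = D \<Longrightarrow> u (add_mset p \<alpha>) * v \<alpha> = 0"
  shows "(\<Sum>\<alpha>\<in>states D. annih p u \<alpha> * v \<alpha>) = (\<Sum>\<alpha>\<in>states D. u \<alpha> * creat p v \<alpha>)"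
proof -
  have "(\<Sum>\<alpha>\<in>states D. annih p u \<alpha> * v \<alpha>) = (\<Sum>\<alpha>\<in>{\<alpha>\<in>states D. size \<alpha> < D}. annih p u \<alpha> * v \<alpha>)"
    using top by (intro sum.mono_neutral_right finite_states) (auto simp: states_def annih_def)
  also have "\<dots> = (\<Sum>\<alpha>\<in>{\<alpha>\<in>states D. p \<in># \<alpha>}. u \<alpha> * creat p v \<alpha>)"
    using p
    by (intro sum.reindex_bij_witness[where i = "\<lambda>\<alpha>. \<alpha> - {#p#}" and j = "add_mset p"])
      (auto simp: states_add_mset annih_def creat_def dest!: multi_member_split)
  also have "\<dots> = (\<Sum>\<alpha>\<in>states D. u \<alpha> * creat p v \<alpha>)"
    by (intro sum.mono_neutral_left finite_states) (auto simp: creat_def not_in_iff)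
  finally show ?thesis .
qed

lemma inner_cnj: "cnj (inner \<psi> \<phi>) = inner \<phi> \<psi>"
  by (simp add: inner_def mult.commute)

lemma inner_self: "inner \<psi> \<psi> = of_real (norm_sq \<psi>)"
  by (simp add: inner_def norm_sq_def complex_norm_square[symmetric])

lemma inner_sum_left: "inner (\<lambda>\<alpha>. \<Sum>u\<in>K. h u \<alpha>) \<phi> = (\<Sum>u\<in>K. inner (h u) \<phi>)"
  unfolding inner_def sum_distrib_right by (rule sum.swap)

lemma inner_sum_right: "inner \<phi> (\<lambda>\<alpha>. \<Sum>u\<in>K. h u \<alpha>) = (\<Sum>u\<in>K. inner \<phi> (h u))"
  unfolding inner_def sum_distrib_left cnj_sum by (rule sum.swap)

lemma inner_annih:
  assumes "deg_le D \<psi>" "snd p \<in> sites"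
  shows "inner (annih p \<psi>) \<phi> = inner \<psi> (creat p \<phi>)"
proof -
  have "\<psi> (add_mset p \<alpha>) = 0" if "size \<alpha> = D" for \<alpha>
    using that assms by (auto simp: deg_le_def states_def)
  moreover have "(\<lambda>\<alpha>. cnj (creat p \<phi> \<alpha>)) = creat p (\<lambda>\<alpha>. cnj (\<phi> \<alpha>))"
    by (simp add: creat_def)
  ultimately show ?thesis
    unfolding inner_def using sum_annih_shift[OF assms(2), of \<psi> "\<lambda>\<alpha>. cnj (\<phi> \<alpha>)"] by (simp add: fun_eq_iff)
qed

lemma inner_comb_left:
  "inner (\<lambda>\<alpha>. (\<psi> \<alpha> + e * \<phi> \<alpha>) / complex_of_real (sqrt 2)) \<xi> = (inner \<psi> \<xi> + e * inner \<phi> \<xi>) / sqrt 2"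
  by (simp add: inner_def sum.distrib sum_distrib_left sum_divide_distrib algebra_simps add_divide_distrib)

lemma inner_comb_right:
  "inner \<xi> (\<lambda>\<alpha>. (\<psi> \<alpha> + e * \<phi> \<alpha>) / complex_of_real (sqrt 2)) = (inner \<xi> \<psi> + cnj e * inner \<xi> \<phi>) / sqrt 2"
  by (simp add: inner_def sum.distrib sum_distrib_left sum_divide_distrib algebra_simps add_divide_distrib)

lemma inner_cannih:
  assumes "deg_le D \<psi>" "u \<in> sites"
  shows "inner (cannih e u \<psi>) \<phi> = inner \<psi> (ccreat (cnj e) u \<phi>)"
  unfolding cannih_def ccreat_def inner_comb_left inner_comb_right
  by (simp add: inner_annih assms)

lemma inner_ccreat:
  assumes "deg_le D \<phi>" "u \<in> sites"
  shows "inner (ccreat e u \<psi>) \<phi> = inner \<psi> (cannih (cnj e) u \<phi>)"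
  using inner_cannih[OF assms, of "cnj e" \<psi>] by (metis inner_cnj complex_cnj_cnj)

lemma norm_sq_nonneg: "0 \<le> norm_sq \<psi>"
  by (simp add: norm_sq_def sum_nonneg)

text \<open>Each summand is the expectation of the occupation number of one mode; summed over the
  modes these give the total number operator, at most \<open>n\<close> on the support of
  \<open>\<psi>\<close>.\<close>

lemma sum_norm_sq_annih:
  assumes "deg_le n \<psi>" "n \<le> D"
  shows "(\<Sum>p\<in>UNIV \<times> sites. norm_sq (annih p \<psi>)) \<le> real n * norm_sq \<psi>"
proof -
  have D: "deg_le D \<psi>" using assms deg_le_mono by blast
  have one: "norm_sq (annih p \<psi>) = (\<Sum>\<alpha>\<in>states D. real (count \<alpha> p) * (cmod (\<psi> \<alpha>))\<^sup>2)"
    if "snd p \<in> sites" for p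
  proof -
    have "complex_of_real (norm_sq (annih p \<psi>)) = inner \<psi> (creat p (annih p \<psi>))"
      using inner_annih[OF D that] by (simp flip: inner_self)
    also have "\<dots> = (\<Sum>\<alpha>\<in>states D. of_real (real (count \<alpha> p) * (cmod (\<psi> \<alpha>))\<^sup>2))"
      unfolding inner_def
    proof (rule sum.cong[OF refl])
      fix \<alpha>
      show "\<psi> \<alpha> * cnj (creat p (annih p \<psi>) \<alpha>) = of_real (real (count \<alpha> p) * (cmod (\<psi> \<alpha>))\<^sup>2)"
        unfolding creat_annih of_real_mult complex_norm_square by simp
    qed
    finally show ?thesis unfolding of_real_sum[symmetric] of_real_eq_iff .
  qed
  have "(\<Sum>p\<in>UNIV \<times> sites. norm_sq (annih p \<psi>))
      = (\<Sum>\<alpha>\<in>states D. \<Sum>p\<in>UNIV \<times> sites. real (count \<alpha> p) * (cmod (\<psi> \<alpha>))\<^sup>2)"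
    using one by (subst sum.swap) (intro sum.cong, auto)
  also have "\<dots> \<le> (\<Sum>\<alpha>\<in>states D. real n * (cmod (\<psi> \<alpha>))\<^sup>2)"
  proof (rule sum_mono)
    fix \<alpha> assume "\<alpha> \<in> states D"
    show "(\<Sum>p\<in>UNIV \<times> sites. real (count \<alpha> p) * (cmod (\<psi> \<alpha>))\<^sup>2) \<le> real n * (cmod (\<psi> \<alpha>))\<^sup>2"
    proof (cases "\<alpha> \<in> states n")
      case True
      have "(\<Sum>p\<in>UNIV \<times> sites. count \<alpha> p) = size \<alpha>"
        unfolding size_multiset_overloaded_eq
        using True by (intro sum.mono_neutral_right) (auto simp: states_def not_in_iff)
      then have "(\<Sum>p\<in>UNIV \<times> sites. count \<alpha> p) \<le> n" using True by (simp add: states_def)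
      then have "(\<Sum>p\<in>UNIV \<times> sites. real (count \<alpha> p)) \<le> real n"
        by (metis of_nat_mono of_nat_sum)
      then show ?thesis by (simp flip: sum_distrib_right add: mult_right_mono)
    qed (use assms in \<open>simp add: deg_le_def\<close>)
  qed
  finally show ?thesis by (simp add: norm_sq_def sum_distrib_left)
qed

text \<open>By \<open>|x + e y|^2 / 2 \<le> |x|^2 + |y|^2\<close> the number bound for the two real
  modes of a site carries over with the same constant.\<close>

lemma sum_norm_sq_cannih:
  assumes "deg_le n \<psi>" "n \<le> D" "cmod e = 1"
  shows "(\<Sum>u\<in>sites. norm_sq (cannih e u \<psi>)) \<le> real n * norm_sq \<psi>"
proof -
  have 1: "(cmod ((x + e * y) / complex_of_real (sqrt 2)))\<^sup>2 \<le> (cmod x)\<^sup>2 + (cmod y)\<^sup>2" for x y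
  proof -
    have "(cmod (x + e * y))\<^sup>2 \<le> (cmod x + cmod y)\<^sup>2"
      using norm_triangle_ineq[of x "e * y"] assms(3) by (simp add: norm_mult power_mono)
    also have "\<dots> \<le> 2 * ((cmod x)\<^sup>2 + (cmod y)\<^sup>2)"
      using sum_squares_bound[of "cmod x" "cmod y"] by (simp add: power2_sum)
    finally show ?thesis by (simp add: norm_divide power_divide)
  qed
  have "(\<Sum>u\<in>sites. norm_sq (cannih e u \<psi>))
      \<le> (\<Sum>u\<in>sites. norm_sq (annih (True, u) \<psi>) + norm_sq (annih (False, u) \<psi>))"
    unfolding norm_sq_def cannih_def sum.distrib[symmetric] by (intro sum_mono 1)
  also have "\<dots> = (\<Sum>p\<in>UNIV \<times> sites. norm_sq (annih p \<psi>))"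
    by (simp only: sum.cartesian_product') (simp add: UNIV_bool sum.distrib add.commute)
  finally show ?thesis using sum_norm_sq_annih[OF assms(1,2)] by linarith
qed

lemma Re_inner_le: "2 * Re (inner \<psi> \<phi>) \<le> norm_sq \<psi> + norm_sq \<phi>"
proof -
  have "2 * Re (x * cnj y) \<le> (cmod x)\<^sup>2 + (cmod y)\<^sup>2" for x y
  proof -
    have "Re (x * cnj y) \<le> cmod x * cmod y" by (metis complex_Re_le_cmod complex_mod_cnj norm_mult)
    then show ?thesis using sum_squares_bound[of "cmod x" "cmod y"] by simp
  qed
  then have "(\<Sum>\<alpha>\<in>states D. 2 * Re (\<psi> \<alpha> * cnj (\<phi> \<alpha>)))
    \<le> (\<Sum>\<alpha>\<in>states D. (cmod (\<psi> \<alpha>))\<^sup>2 + (cmod (\<phi> \<alpha>))\<^sup>2)"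
    by (intro sum_mono)
  then show ?thesis
    by (simp add: inner_def norm_sq_def sum.distrib sum_distrib_left)
qed

text \<open>Expand the square and commute one creation operator past another. As the sites are
  distinct and \<open>cnj e * e = 1\<close>, the commutators leave just the diagonal
  \<open>norm_sq (h k)\<close>. The exchange terms pair \<open>x k l\<close> with
  \<open>x l k\<close>, so \<open>2 Re \<langle>x, y\<rangle> \<le> |x|^2 + |y|^2\<close> and the
  symmetry in \<open>k\<close>, \<open>l\<close> bound them.\<close>

lemma norm_sq_sum_ccreat:
  assumes K: "finite K" "inj_on \<pi> K" "\<pi> ` K \<subseteq> sites"
    and deg: "\<And>k. k \<in> K \<Longrightarrow> deg_le n (h k)" "Suc n \<le> D" and e: "cmod e = 1"
  shows "norm_sq (\<lambda>\<alpha>. \<Sum>k\<in>K. ccreat e (\<pi> k) (h k) \<alpha>)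
     \<le> (\<Sum>k\<in>K. norm_sq (h k)) + (\<Sum>k\<in>K. \<Sum>l\<in>K. norm_sq (cannih (cnj e) (\<pi> l) (h k)))"
proof -
  define x where "x k l = cannih (cnj e) (\<pi> l) (h k)" for k l
  have s: "\<pi> k \<in> sites" if "k \<in> K" for k using that K by auto
  have D: "deg_le D (h k)" "deg_le D (ccreat e (\<pi> k) (h k))" "deg_le D (x k l)" if "k \<in> K" for k l
    using deg(1)[OF that] deg(2) deg_le_ccreat[OF _ s[OF that]] deg_le_cannih deg_le_mono Suc_leD
    unfolding x_def by meson+
  have ee: "cnj e * e = 1" using e by (simp add: complex_norm_square[symmetric] mult.commute)
  have pair: "inner (ccreat e (\<pi> k) (h k)) (ccreat e (\<pi> l) (h l))
      = inner (x k l) (x l k) + (if k = l then of_real (norm_sq (h k)) else 0)" if "k \<in> K" "l \<in> K" for k l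
  proof -
    have "inner (ccreat e (\<pi> k) (h k)) (ccreat e (\<pi> l) (h l)) = inner (cannih (cnj e) (\<pi> l) (ccreat e (\<pi> k) (h k))) (h l)"
      using inner_cannih[OF D(2)[OF that(1)] s[OF that(2)], of "cnj e"] by simp
    also have "cannih (cnj e) (\<pi> l) (ccreat e (\<pi> k) (h k))
        = (\<lambda>\<alpha>. ccreat e (\<pi> k) (x k l) \<alpha> + (if k = l then h k \<alpha> else 0))"
      using inj_onD[OF K(2) _ that] by (auto simp: cannih_ccreat ee x_def fun_eq_iff)
    also have "inner \<dots> (h l) = inner (ccreat e (\<pi> k) (x k l)) (h l) + (if k = l then of_real (norm_sq (h k)) else 0)"
      by (auto simp: inner_def inner_self[symmetric] sum.distrib algebra_simps)
    also have "inner (ccreat e (\<pi> k) (x k l)) (h l) = inner (x k l) (x l k)"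
      unfolding inner_ccreat[OF D(1)[OF that(2)] s[OF that(1)]] by (simp add: x_def)
    finally show ?thesis .
  qed
  have "complex_of_real (norm_sq (\<lambda>\<alpha>. \<Sum>k\<in>K. ccreat e (\<pi> k) (h k) \<alpha>))
      = (\<Sum>k\<in>K. \<Sum>l\<in>K. inner (ccreat e (\<pi> k) (h k)) (ccreat e (\<pi> l) (h l)))"
    unfolding inner_self[symmetric] inner_sum_left inner_sum_right by simp
  also have "\<dots> = (\<Sum>k\<in>K. \<Sum>l\<in>K. inner (x k l) (x l k)) + of_real (\<Sum>k\<in>K. norm_sq (h k))"
    using K(1) by (simp add: pair sum.distrib cong: sum.cong)
  finally have eq: "norm_sq (\<lambda>\<alpha>. \<Sum>k\<in>K. ccreat e (\<pi> k) (h k) \<alpha>)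
      = (\<Sum>k\<in>K. \<Sum>l\<in>K. Re (inner (x k l) (x l k))) + (\<Sum>k\<in>K. norm_sq (h k))"
    by (metis (no_types, lifting) Re_complex_of_real Re_sum plus_complex.simps(1) sum.cong)
  have "2 * (\<Sum>k\<in>K. \<Sum>l\<in>K. Re (inner (x k l) (x l k))) \<le> (\<Sum>k\<in>K. \<Sum>l\<in>K. norm_sq (x k l) + norm_sq (x l k))"
    unfolding sum_distrib_left by (intro sum_mono Re_inner_le)
  also have "\<dots> = 2 * (\<Sum>k\<in>K. \<Sum>l\<in>K. norm_sq (x k l))"
    using sum.swap[of "\<lambda>k l. norm_sq (x l k)" K K] by (simp add: sum.distrib)
  finally show ?thesis using eq by (simp add: x_def)
qed

end


section \<open>The matrix-valued field operator\<close>

text \<open>The flag \<open>t\<close> selects \<open>G\<close> (true) or its adjoint (false), for which the phase is conjugated and the two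
  indices are exchanged.\<close>

definition phase :: "bool \<Rightarrow> complex" where
  "phase t = (if t then \<i> else - \<i>)"

definition site_of :: "bool \<Rightarrow> nat \<Rightarrow> nat \<Rightarrow> site" where
  "site_of t i j = (if t then (i, j) else (j, i))"

lemma phase_simps [simp]: "cmod (phase t) = 1" "cnj (phase t) = phase (\<not> t)" "phase t * phase t = -1"
  by (auto simp: phase_def)

lemma site_of_eq_iff [simp]: "site_of t i j = site_of t k l \<longleftrightarrow> i = k \<and> j = l"
  by (auto simp: site_of_def)

lemma site_of_not: "site_of (\<not> t) i j = site_of t j i"
  by (simp add: site_of_def)

text \<open>Error constant for the words discarded from the k-th power. One more factor multiplies
  the old error by at most \<open>2 * s\<close>, and creates a new word \<open>down\<close> after
  \<open>up\<close> of norm at most \<open>\<tau>\<close> on an ordered sum of \<open>k\<close>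
  terms. It is used with \<open>s = sqrt (1 + D / N)\<close> and
  \<open>\<tau> = D / N\<close>.\<close>

fun excess :: "real \<Rightarrow> real \<Rightarrow> nat \<Rightarrow> real" where
  "excess s \<tau> 0 = 0"
| "excess s \<tau> (Suc k) = 2 * s * excess s \<tau> k + \<tau> * (real k * s ^ (k - 1))"

context fock_space
begin

definition up :: "bool \<Rightarrow> (nat \<Rightarrow> fock) \<Rightarrow> nat \<Rightarrow> fock" where
  "up t f = (\<lambda>i \<alpha>. (\<Sum>j<N. ccreat (phase t) (site_of t i j) (f j) \<alpha>) / complex_of_real (sqrt (real N)))"

definition down :: "bool \<Rightarrow> (nat \<Rightarrow> fock) \<Rightarrow> nat \<Rightarrow> fock" where
  "down t f = (\<lambda>i \<alpha>. (\<Sum>j<N. cannih (phase t) (site_of t i j) (f j) \<alpha>) / complex_of_real (sqrt (real N)))"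

definition vnorm :: "(nat \<Rightarrow> fock) \<Rightarrow> real" where
  "vnorm f = sqrt (\<Sum>i<N. norm_sq (f i))"

definition vinner :: "(nat \<Rightarrow> fock) \<Rightarrow> (nat \<Rightarrow> fock) \<Rightarrow> complex" where
  "vinner f g = (\<Sum>i<N. inner (f i) (g i))"

definition vdeg :: "nat \<Rightarrow> (nat \<Rightarrow> fock) \<Rightarrow> bool" where
  "vdeg n f \<longleftrightarrow> (\<forall>i<N. deg_le n (f i))"

lemma site_of_sites: "i < N \<Longrightarrow> j < N \<Longrightarrow> site_of t i j \<in> sites"
  by (auto simp: site_of_def sites_def)

lemma sum_site_of: "(\<Sum>i<N. \<Sum>j<N. F (site_of t i j)) = (\<Sum>u\<in>sites. F u)"
proof (cases t)
  case True
  then show ?thesis by (simp add: site_of_def sites_def sum.cartesian_product)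
next
  case False
  then show ?thesis
    using sum.swap[of "\<lambda>i j. F (j, i)" "{..<N}" "{..<N}"]
    by (simp add: site_of_def sites_def sum.cartesian_product)
qed

lemma vnorm_L2: "vnorm f = L2_set (\<lambda>(i, \<alpha>). cmod (f i \<alpha>)) ({..<N} \<times> states D)"
  by (simp add: vnorm_def norm_sq_def L2_set_def sum.cartesian_product case_prod_unfold)

lemma vnorm_nonneg [simp]: "0 \<le> vnorm f"
  by (simp add: vnorm_L2)

lemma vnorm_sq: "(vnorm f)\<^sup>2 = (\<Sum>i<N. norm_sq (f i))"
  by (simp add: vnorm_def sum_nonneg norm_sq_nonneg)

lemma vnorm_add: "vnorm (f + g) \<le> vnorm f + vnorm g"
proof -
  have "vnorm (f + g) \<le> L2_set (\<lambda>x. (case x of (i, \<alpha>) \<Rightarrow> cmod (f i \<alpha>)) + (case x of (i, \<alpha>) \<Rightarrow> cmod (g i \<alpha>)))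
      ({..<N} \<times> states D)"
    unfolding vnorm_L2 by (intro L2_set_mono) (auto intro: norm_triangle_ineq)
  also have "\<dots> \<le> vnorm f + vnorm g"
    unfolding vnorm_L2 by (rule L2_set_triangle_ineq)
  finally show ?thesis .
qed

lemma vnorm_zero [simp]: "vnorm 0 = 0"
  by (simp add: vnorm_def norm_sq_def)

lemma vinner_self: "vinner f f = of_real ((vnorm f)\<^sup>2)"
  by (simp add: vinner_def inner_self vnorm_sq)

lemma cmod_vinner_le: "cmod (vinner f g) \<le> vnorm f * vnorm g"
proof -
  have "cmod (vinner f g) \<le> (\<Sum>x\<in>{..<N} \<times> states D. cmod (f (fst x) (snd x)) * cmod (g (fst x) (snd x)))"
    unfolding vinner_def inner_def sum.cartesian_product
    by (rule order_trans[OF norm_sum]) (auto simp: norm_mult case_prod_unfold)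
  also have "\<dots> \<le> vnorm f * vnorm g"
    using L2_set_mult_ineq[of "\<lambda>x. cmod (f (fst x) (snd x))" "\<lambda>x. cmod (g (fst x) (snd x))"]
    by (simp add: vnorm_L2 case_prod_unfold)
  finally show ?thesis .
qed

lemma vdeg_mono: "vdeg m f \<Longrightarrow> m \<le> n \<Longrightarrow> vdeg n f"
  using deg_le_mono by (auto simp: vdeg_def)

lemma vdeg_zero [simp]: "vdeg n 0"
  by (simp add: vdeg_def deg_le_def)

lemma vdeg_add: "vdeg n f \<Longrightarrow> vdeg n g \<Longrightarrow> vdeg n (f + g)"
  by (simp add: vdeg_def deg_le_def)

lemma deg_le_sum_div:
  "(\<And>j. j \<in> K \<Longrightarrow> deg_le n (h j)) \<Longrightarrow> deg_le n (\<lambda>\<alpha>. (\<Sum>j\<in>K. h j \<alpha>) / c)"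
  by (simp add: deg_le_def)

lemma vdeg_up: "vdeg n f \<Longrightarrow> vdeg (Suc n) (up t f)"
  by (auto simp: vdeg_def up_def intro!: deg_le_sum_div deg_le_ccreat site_of_sites)

lemma vdeg_down: "vdeg n f \<Longrightarrow> vdeg n (down t f)"
  by (auto simp: vdeg_def down_def intro!: deg_le_sum_div deg_le_cannih)

lemma up_add: "up t (f + g) = up t f + up t g"
  by (simp add: up_def ccreat_def creat_def fun_eq_iff sum.distrib add_divide_distrib sum_divide_distrib
      ring_distribs)

lemma down_add: "down t (f + g) = down t f + down t g"
  by (simp add: down_def cannih_def annih_def fun_eq_iff sum.distrib add_divide_distrib sum_divide_distrib
      ring_distribs)

section \<open>Norms of \<open>up\<close>, of \<open>down\<close>, and of \<open>down\<close> after
  \<open>up\<close>\<close>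

lemma norm_sq_div: "norm_sq (\<lambda>\<alpha>. \<psi> \<alpha> / complex_of_real (sqrt (real N))) = norm_sq \<psi> / N"
  by (simp add: norm_sq_def norm_divide power_divide sum_divide_distrib)

text \<open>Row \<open>i\<close> creates at the distinct sites with first index \<open>i\<close>.
  The diagonal terms of the \<open>N\<close> rows, divided by \<open>N\<close>, give
  \<open>(vnorm f)\<^sup>2\<close>; in the exchange terms \<open>(i, l)\<close> runs over all sites,
  so the number bound adds \<open>D / N\<close> times the same.\<close>

lemma vnorm_up:
  assumes f: "vdeg n f" and n: "Suc n \<le> D"
  shows "vnorm (up t f) \<le> sqrt (1 + D / N) * vnorm f"
proof -
  have fj: "deg_le n (f j)" if "j < N" for j using f that by (simp add: vdeg_def)
  have row: "norm_sq (\<lambda>\<alpha>. \<Sum>j<N. ccreat (phase t) (site_of t i j) (f j) \<alpha>)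
      \<le> (\<Sum>j<N. norm_sq (f j)) + (\<Sum>j<N. \<Sum>l<N. norm_sq (cannih (phase (\<not> t)) (site_of t i l) (f j)))"
    if "i < N" for i
    using norm_sq_sum_ccreat[of "{..<N}" "site_of t i" n f "phase t"] fj that n
    by (simp add: inj_on_def site_of_sites image_subset_iff)
  have "(vnorm (up t f))\<^sup>2 = (\<Sum>i<N. norm_sq (\<lambda>\<alpha>. \<Sum>j<N. ccreat (phase t) (site_of t i j) (f j) \<alpha>)) / N"
    by (simp add: vnorm_sq up_def norm_sq_div sum_divide_distrib[symmetric])
  also have "\<dots> \<le> (\<Sum>i<N. (\<Sum>j<N. norm_sq (f j))
      + (\<Sum>j<N. \<Sum>l<N. norm_sq (cannih (phase (\<not> t)) (site_of t i l) (f j)))) / N"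
    by (intro divide_right_mono sum_mono row) auto
  also have "\<dots> = (vnorm f)\<^sup>2 + (\<Sum>j<N. \<Sum>u\<in>sites. norm_sq (cannih (phase (\<not> t)) u (f j))) / N"
    unfolding sum_site_of[symmetric, of _ t] sum.distrib vnorm_sq
    using N_pos by (subst (4) sum.swap) (simp add: add_divide_distrib)
  also have "(\<Sum>j<N. \<Sum>u\<in>sites. norm_sq (cannih (phase (\<not> t)) u (f j))) \<le> (\<Sum>j<N. real D * norm_sq (f j))"
  proof (rule sum_mono)
    fix j assume "j \<in> {..<N}"
    then have "(\<Sum>u\<in>sites. norm_sq (cannih (phase (\<not> t)) u (f j))) \<le> real n * norm_sq (f j)"
      using n by (intro sum_norm_sq_cannih fj) auto
    also have "\<dots> \<le> real D * norm_sq (f j)" using n by (intro mult_right_mono norm_sq_nonneg) auto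
    finally show "(\<Sum>u\<in>sites. norm_sq (cannih (phase (\<not> t)) u (f j))) \<le> real D * norm_sq (f j)" .
  qed
  also have "\<dots> = real D * (vnorm f)\<^sup>2" by (simp add: vnorm_sq sum_distrib_left)
  finally have "(vnorm (up t f))\<^sup>2 \<le> (vnorm f)\<^sup>2 + real D * (vnorm f)\<^sup>2 / N"
    by (simp add: divide_right_mono)
  also have "\<dots> = (sqrt (1 + D / N) * vnorm f)\<^sup>2"
    by (simp add: power_mult_distrib ring_distribs)
  finally show ?thesis by (rule power2_le_imp_le) simp
qed

lemma inner_div:
  "inner (\<lambda>\<alpha>. \<psi> \<alpha> / complex_of_real c) \<phi> = inner \<psi> \<phi> / c"
  "inner \<phi> (\<lambda>\<alpha>. \<psi> \<alpha> / complex_of_real c) = inner \<phi> \<psi> / c"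
  by (simp_all add: inner_def sum_divide_distrib)

text \<open>Taking adjoints conjugates the phase and exchanges the two matrix indices; both changes
  amount to negating the flag.\<close>

lemma vinner_down:
  assumes f: "vdeg D f"
  shows "vinner (down t f) g = vinner f (up (\<not> t) g)"
proof -
  have "vinner (down t f) g = (\<Sum>i<N. \<Sum>j<N. inner (cannih (phase t) (site_of t i j) (f j)) (g i)) / sqrt N"
    by (simp add: vinner_def down_def inner_div inner_sum_left sum_divide_distrib)
  also have "\<dots> = (\<Sum>i<N. \<Sum>j<N. inner (f j) (ccreat (phase (\<not> t)) (site_of t i j) (g i))) / sqrt N"
    using f by (simp add: vdeg_def inner_cannih site_of_sites)
  also have "\<dots> = (\<Sum>j<N. \<Sum>i<N. inner (f j) (ccreat (phase (\<not> t)) (site_of t i j) (g i))) / sqrt N"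
    by (subst sum.swap) simp
  also have "\<dots> = vinner f (up (\<not> t) g)"
    unfolding vinner_def up_def site_of_not by (simp add: inner_div inner_sum_right sum_divide_distrib)
  finally show ?thesis .
qed

text \<open>An operator and its adjoint have the same norm: write
  \<open>(vnorm (down t f))\<^sup>2\<close> as the inner product of \<open>f\<close> with
  \<open>up (\<not> t) (down t f)\<close> and cancel one factor.\<close>

lemma vnorm_down:
  assumes f: "vdeg n f" and n: "Suc n \<le> D"
  shows "vnorm (down t f) \<le> sqrt (1 + D / N) * vnorm f"
proof -
  have "complex_of_real ((vnorm (down t f))\<^sup>2) = vinner f (up (\<not> t) (down t f))"
    unfolding vinner_self[symmetric] using vdeg_mono[OF f] n by (simp add: vinner_down)
  then have "(vnorm (down t f))\<^sup>2 \<le> vnorm f * vnorm (up (\<not> t) (down t f))"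
    using cmod_vinner_le[of f "up (\<not> t) (down t f)"] by (metis norm_of_real abs_of_nonneg zero_le_power2)
  also have "\<dots> \<le> vnorm f * (sqrt (1 + D / N) * vnorm (down t f))"
    by (intro mult_left_mono vnorm_up[OF vdeg_down[OF f] n]) simp
  finally have "vnorm (down t f) * vnorm (down t f) \<le> (sqrt (1 + D / N) * vnorm f) * vnorm (down t f)"
    by (simp add: power2_eq_square mult_ac)
  then show ?thesis
    by (metis mult_right_le_imp_le vnorm_nonneg less_eq_real_def mult_nonneg_nonneg real_sqrt_ge_zero
        of_nat_0_le_iff add_nonneg_nonneg divide_nonneg_nonneg zero_le_one)
qed

text \<open>Much better than the product of the two separate bounds. With equal phases the operators
  commute, so all annihilations may act first. Then the sum of creations over the distinct sites
  \<open>(j, l)\<close> costs a factor \<open>D\<close> in the square, the annihilations over all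
  sites cost another, and the prefactor is \<open>1 / N\<^sup>2\<close>.\<close>

lemma vnorm_down_up:
  assumes f: "vdeg n f" and n: "Suc n \<le> D"
  shows "vnorm (down t (up t f)) \<le> (D / N) * vnorm f"
proof -
  define h where "h i = (\<lambda>(j, l). cannih (phase t) (site_of t i j) (f l))" for i
  define K where "K = {..<N} \<times> {..<N}"
  have deg: "deg_le n (h i k)" if "k \<in> K" for i k
    using f that by (auto simp: h_def K_def vdeg_def intro!: deg_le_cannih)
  have du_apply: "down t (up t f) i \<alpha>
      = (\<Sum>k\<in>K. ccreat (phase t) (site_of t (fst k) (snd k)) (h i k) \<alpha>) / complex_of_real (real N)" for i \<alpha>
  proof -
    have lin: "cannih e u (\<lambda>\<alpha>. (\<Sum>l<N. \<psi> l \<alpha>) / complex_of_real (sqrt (real N))) \<alpha>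
       = (\<Sum>l<N. cannih e u (\<psi> l) \<alpha>) / complex_of_real (sqrt (real N))" for e u and \<psi> :: "nat \<Rightarrow> fock"
      by (simp add: cannih_def annih_def sum_distrib_left sum.distrib sum_divide_distrib add_divide_distrib
          ring_distribs mult_ac)
    have "complex_of_real (sqrt (real N)) * complex_of_real (sqrt (real N)) = of_nat N"
      by (simp flip: of_real_mult)
    \<comment> \<open>The commutator vanishes even at equal sites, because
      \<open>phase t * phase t = -1\<close>.\<close>
    moreover have "cannih (phase t) u (ccreat (phase t) v \<psi>) \<alpha> = ccreat (phase t) v (cannih (phase t) u \<psi>) \<alpha>"
      for u v \<psi> by (simp add: cannih_ccreat)
    ultimately show ?thesis
      unfolding down_def up_def lin K_def sum.cartesian_product' h_def
      by (simp add: sum_divide_distrib)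
  qed
  have du: "down t (up t f) i = (\<lambda>\<alpha>. (\<Sum>k\<in>K. ccreat (phase t) (site_of t (fst k) (snd k)) (h i k) \<alpha>)
      / complex_of_real (real N))" for i
    by (rule ext) (rule du_apply)
  have dsq: "norm_sq (\<lambda>\<alpha>. \<psi> \<alpha> / complex_of_real (real N)) = norm_sq \<psi> / (real N)\<^sup>2" for \<psi>
    by (simp add: norm_sq_def norm_divide power_divide sum_divide_distrib)
  have fin: "finite K" by (simp add: K_def)
  have row: "norm_sq (\<lambda>\<alpha>. \<Sum>k\<in>K. ccreat (phase t) (site_of t (fst k) (snd k)) (h i k) \<alpha>)
      \<le> real D * (\<Sum>k\<in>K. norm_sq (h i k))" for i
  proof -
    have "norm_sq (\<lambda>\<alpha>. \<Sum>k\<in>K. ccreat (phase t) (site_of t (fst k) (snd k)) (h i k) \<alpha>)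
      \<le> (\<Sum>k\<in>K. norm_sq (h i k)) + (\<Sum>k\<in>K. \<Sum>l\<in>K. norm_sq (cannih (cnj (phase t)) (site_of t (fst l) (snd l)) (h i k)))"
      using deg n by (intro norm_sq_sum_ccreat[OF fin]) (auto simp: inj_on_def K_def site_of_sites)
    also have "(\<Sum>k\<in>K. \<Sum>l\<in>K. norm_sq (cannih (cnj (phase t)) (site_of t (fst l) (snd l)) (h i k)))
        \<le> (\<Sum>k\<in>K. real n * norm_sq (h i k))"
    proof (rule sum_mono)
      fix k assume k: "k \<in> K"
      have "(\<Sum>l\<in>K. norm_sq (cannih (cnj (phase t)) (site_of t (fst l) (snd l)) (h i k)))
          = (\<Sum>u\<in>sites. norm_sq (cannih (cnj (phase t)) u (h i k)))"
        unfolding K_def sum.cartesian_product' using sum_site_of[of _ t] by simp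
      also have "\<dots> \<le> real n * norm_sq (h i k)"
        using n by (intro sum_norm_sq_cannih deg k) auto
      finally show "(\<Sum>l\<in>K. norm_sq (cannih (cnj (phase t)) (site_of t (fst l) (snd l)) (h i k)))
          \<le> real n * norm_sq (h i k)" .
    qed
    also have "(\<Sum>k\<in>K. norm_sq (h i k)) + (\<Sum>k\<in>K. real n * norm_sq (h i k)) = real (Suc n) * (\<Sum>k\<in>K. norm_sq (h i k))"
      by (simp add: sum_distrib_left[symmetric] algebra_simps)
    also have "\<dots> \<le> real D * (\<Sum>k\<in>K. norm_sq (h i k))"
      using n by (intro mult_right_mono sum_nonneg norm_sq_nonneg) simp
    finally show ?thesis by simp
  qed
  have "(vnorm (down t (up t f)))\<^sup>2
      = (\<Sum>i<N. norm_sq (\<lambda>\<alpha>. \<Sum>k\<in>K. ccreat (phase t) (site_of t (fst k) (snd k)) (h i k) \<alpha>)) / (real N)\<^sup>2"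
    unfolding vnorm_sq du dsq by (simp only: sum_divide_distrib)
  also have "\<dots> \<le> (\<Sum>i<N. real D * (\<Sum>k\<in>K. norm_sq (h i k))) / (real N)\<^sup>2"
    by (intro divide_right_mono sum_mono row) auto
  also have "(\<Sum>i<N. real D * (\<Sum>k\<in>K. norm_sq (h i k))) = real D * (\<Sum>i<N. \<Sum>k\<in>K. norm_sq (h i k))"
    by (simp add: sum_distrib_left)
  also have "(\<Sum>i<N. \<Sum>k\<in>K. norm_sq (h i k)) = (\<Sum>l<N. \<Sum>u\<in>sites. norm_sq (cannih (phase t) u (f l)))"
  proof -
    have "(\<Sum>i<N. \<Sum>k\<in>K. norm_sq (h i k)) = (\<Sum>i<N. \<Sum>l<N. \<Sum>j<N. norm_sq (cannih (phase t) (site_of t i j) (f l)))"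
      unfolding K_def sum.cartesian_product' h_def by (subst (2) sum.swap) simp
    also have "\<dots> = (\<Sum>l<N. \<Sum>i<N. \<Sum>j<N. norm_sq (cannih (phase t) (site_of t i j) (f l)))"
      by (rule sum.swap)
    also have "\<dots> = (\<Sum>l<N. \<Sum>u\<in>sites. norm_sq (cannih (phase t) u (f l)))"
      by (intro sum.cong refl sum_site_of)
    finally show ?thesis .
  qed
  also have "real D * \<dots> \<le> real D * (\<Sum>l<N. real D * norm_sq (f l))"
  proof (intro mult_left_mono sum_mono)
    fix l assume "l \<in> {..<N}"
    then have "(\<Sum>u\<in>sites. norm_sq (cannih (phase t) u (f l))) \<le> real n * norm_sq (f l)"
      using f n by (intro sum_norm_sq_cannih) (auto simp: vdeg_def)
    also have "\<dots> \<le> real D * norm_sq (f l)" using n by (intro mult_right_mono norm_sq_nonneg) auto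
    finally show "(\<Sum>u\<in>sites. norm_sq (cannih (phase t) u (f l))) \<le> real D * norm_sq (f l)" .
  qed simp
  also have "\<dots> = real D * (real D * (vnorm f)\<^sup>2)" by (simp add: vnorm_sq sum_distrib_left)
  finally have "(vnorm (down t (up t f)))\<^sup>2 \<le> real D * (real D * (vnorm f)\<^sup>2) / (real N)\<^sup>2"
    by (simp add: divide_right_mono)
  also have "\<dots> = (D / N * vnorm f)\<^sup>2"
    by (simp add: power_mult_distrib power_divide power2_eq_square)
  finally show ?thesis by (rule power2_le_imp_le) simp
qed

section \<open>Normal ordering of the powers of the field operator\<close>

definition field_op :: "bool \<Rightarrow> (nat \<Rightarrow> fock) \<Rightarrow> nat \<Rightarrow> fock" where
  "field_op t f = up t f + down t f"

text \<open>The sum over \<open>j \<le> k\<close> of \<open>up t ^^ j\<close> after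
  \<open>down t ^^ (k - j)\<close>; the recursion splits off the term \<open>j = 0\<close>.\<close>

fun ordered :: "bool \<Rightarrow> nat \<Rightarrow> (nat \<Rightarrow> fock) \<Rightarrow> nat \<Rightarrow> fock" where
  "ordered t 0 f = f"
| "ordered t (Suc k) f = up t (ordered t k f) + (down t ^^ Suc k) f"

lemma field_op_add: "field_op t (f + g) = field_op t f + field_op t g"
  by (simp add: field_op_def up_add down_add ac_simps)

lemma vdeg_field_op: "vdeg n f \<Longrightarrow> vdeg (Suc n) (field_op t f)"
  unfolding field_op_def by (intro vdeg_add vdeg_up vdeg_mono[OF vdeg_down]) auto

lemma vdeg_field_op_pow: "vdeg n f \<Longrightarrow> vdeg (n + k) ((field_op t ^^ k) f)"
  by (induction k) (auto dest: vdeg_field_op)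

lemma vdeg_down_pow: "vdeg n f \<Longrightarrow> vdeg n ((down t ^^ k) f)"
  by (induction k) (auto dest: vdeg_down)

lemma vnorm_field_op:
  assumes "vdeg n f" "Suc n \<le> D"
  shows "vnorm (field_op t f) \<le> 2 * sqrt (1 + D / N) * vnorm f"
  using vnorm_add[of "up t f" "down t f"] vnorm_up[OF assms, of t] vnorm_down[OF assms, of t]
  by (simp add: field_op_def)

lemma vnorm_down_pow:
  assumes "vdeg n f" "Suc n \<le> D"
  shows "vnorm ((down t ^^ k) f) \<le> sqrt (1 + D / N) ^ k * vnorm f"
proof (induction k)
  case (Suc k)
  have "vnorm ((down t ^^ Suc k) f) \<le> sqrt (1 + D / N) * vnorm ((down t ^^ k) f)"
    using vnorm_down[OF vdeg_down_pow[OF assms(1)] assms(2)] by simp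
  also have "\<dots> \<le> sqrt (1 + D / N) * (sqrt (1 + D / N) ^ k * vnorm f)"
    by (intro mult_left_mono Suc) simp
  finally show ?case by (simp add: mult_ac)
qed simp

lemma vdeg_ordered: "vdeg n f \<Longrightarrow> vdeg (n + k) (ordered t k f)"
  by (induction k) (auto simp del: funpow.simps intro!: vdeg_add vdeg_up vdeg_mono[OF vdeg_down_pow])

text \<open>There are \<open>k + 1\<close> ordered words of \<open>k\<close> letters, each letter of
  norm at most \<open>sqrt (1 + D / N)\<close>. This count is the source of the constant
  \<open>k + 1\<close> in the limit.\<close>

lemma vnorm_ordered:
  assumes "vdeg n f" "Suc n + k \<le> D"
  shows "vnorm (ordered t k f) \<le> (real k + 1) * sqrt (1 + D / N) ^ k * vnorm f"
  using assms(2)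
proof (induction k)
  case (Suc k)
  let ?s = "sqrt (1 + D / N)"
  have "vnorm (ordered t (Suc k) f) \<le> vnorm (up t (ordered t k f)) + vnorm ((down t ^^ Suc k) f)"
    unfolding ordered.simps by (rule vnorm_add)
  also have "\<dots> \<le> ?s * vnorm (ordered t k f) + ?s ^ Suc k * vnorm f"
    using Suc.prems by (intro add_mono vnorm_up[OF vdeg_ordered[OF assms(1)]] vnorm_down_pow[OF assms(1)]) auto
  also have "\<dots> \<le> ?s * ((real k + 1) * ?s ^ k * vnorm f) + ?s ^ Suc k * vnorm f"
    using Suc by (intro add_mono mult_left_mono) auto
  also have "\<dots> = (real (Suc k) + 1) * ?s ^ Suc k * vnorm f" by (simp add: algebra_simps)
  finally show ?case .
qed simp

text \<open>Induction on \<open>k\<close>. Applying \<open>up\<close> keeps the words ordered.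
  Applying \<open>down\<close> to the ordered sum gives the pure power of \<open>down\<close>, which
  is ordered, and otherwise words in which \<open>down\<close> meets \<open>up\<close>; these join
  the error \<open>E\<close>.\<close>

lemma field_op_pow_split:
  assumes "vdeg n f" "Suc n + k \<le> D"
  shows "\<exists>E. (field_op t ^^ k) f = ordered t k f + E \<and> vdeg (n + k) E
           \<and> vnorm E \<le> excess (sqrt (1 + D / N)) (D / N) k * vnorm f"
  using assms(2)
proof (induction k)
  case 0
  have "vnorm 0 \<le> excess (sqrt (1 + D / N)) (D / N) 0 * vnorm f" unfolding vnorm_zero by simp
  moreover have "(field_op t ^^ 0) f = ordered t 0 f + 0" by (simp add: fun_eq_iff)
  ultimately show ?case using vdeg_zero by blast
next
  case (Suc k)
  let ?s = "sqrt (1 + D / N)"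
  obtain E where E: "(field_op t ^^ k) f = ordered t k f + E" "vdeg (n + k) E" "vnorm E \<le> excess ?s (D / N) k * vnorm f"
    using Suc.IH Suc.prems by (metis Suc_leD add_Suc_right)
  \<comment> \<open>For \<open>k = 0\<close> the ordered sum contains no \<open>up\<close>, so no
    remainder arises.\<close>
  define R where "R = (case k of 0 \<Rightarrow> 0 | Suc l \<Rightarrow> down t (up t (ordered t l f)))"
  have R: "down t (ordered t k f) = (down t ^^ Suc k) f + R"
    by (cases k) (auto simp: R_def down_add ac_simps)
  have R_deg: "vdeg (n + Suc k) R"
    using assms(1) by (cases k) (auto simp: R_def intro!: vdeg_mono[OF vdeg_down[OF vdeg_up[OF vdeg_ordered]]])
  have R_vnorm: "vnorm R \<le> D / N * (real k * ?s ^ (k - 1)) * vnorm f"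
  proof (cases k)
    case (Suc l)
    have "vnorm R \<le> D / N * vnorm (ordered t l f)"
      using Suc.prems Suc vnorm_down_up[OF vdeg_ordered[OF assms(1)], of l t] by (simp add: R_def)
    also have "\<dots> \<le> D / N * ((real l + 1) * ?s ^ l * vnorm f)"
      using Suc.prems assms(1) Suc by (intro mult_left_mono vnorm_ordered) auto
    finally show ?thesis using Suc by (simp add: mult_ac add.commute)
  qed (simp add: R_def)
  have "(field_op t ^^ Suc k) f = field_op t (ordered t k f) + field_op t E"
    using E(1) by (simp add: field_op_add)
  also have "field_op t (ordered t k f) = ordered t (Suc k) f + R"
    using R by (simp add: field_op_def ac_simps)
  finally have "(field_op t ^^ Suc k) f = ordered t (Suc k) f + (field_op t E + R)"
    by (simp only: add.assoc add.commute[of R])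
  moreover have "vdeg (n + Suc k) (field_op t E + R)"
    using vdeg_field_op[OF E(2)] R_deg by (intro vdeg_add) auto
  moreover have "vnorm (field_op t E + R) \<le> excess ?s (D / N) (Suc k) * vnorm f"
  proof -
    have "vnorm (field_op t E + R) \<le> 2 * ?s * vnorm E + vnorm R"
      using vnorm_add[of "field_op t E" R] vnorm_field_op[OF E(2), of t] Suc.prems by simp
    also have "\<dots> \<le> 2 * ?s * (excess ?s (D / N) k * vnorm f) + D / N * (real k * ?s ^ (k - 1)) * vnorm f"
      by (intro add_mono mult_left_mono E(3) R_vnorm) simp
    finally show ?thesis by (simp add: algebra_simps)
  qed
  ultimately show ?case by blast
qed

text \<open>Tends to \<open>k + 1\<close> as \<open>D / N\<close> tends to 0.\<close>

definition gain :: "nat \<Rightarrow> real" where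
  "gain k = (real k + 1) * sqrt (1 + D / N) ^ k + excess (sqrt (1 + D / N)) (D / N) k"

lemma vnorm_field_op_pow:
  assumes "vdeg n f" "Suc n + k \<le> D"
  shows "vnorm ((field_op t ^^ k) f) \<le> gain k * vnorm f"
  using field_op_pow_split[OF assms, of t] vnorm_ordered[OF assms, of t] vnorm_add
  unfolding gain_def by (smt (verit, best) ring_distribs(2))

end


section \<open>Hermite polynomials and Gaussian moments\<close>

text \<open>The monic Hermite polynomials of probability theory, orthogonal for the standard
  Gaussian weight.\<close>

fun hermite :: "nat \<Rightarrow> real poly" where
  "hermite 0 = 1"
| "hermite (Suc 0) = [:0, 1:]"
| "hermite (Suc (Suc n)) = [:0, 1:] * hermite (Suc n) - Polynomial.smult (real (Suc n)) (hermite n)"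

text \<open>The Appell property. Differentiating the recurrence produces the recurrence one degree
  lower, which recombines with the term from the product rule.\<close>

lemma pderiv_hermite: "pderiv (hermite (Suc n)) = Polynomial.smult (real (Suc n)) (hermite n)"
proof (induction n rule: less_induct)
  case (less n)
  show ?case
  proof (cases n)
    case 0
    then show ?thesis by (simp add: pderiv_pCons)
  next
    case (Suc m)
    have IH: "pderiv (hermite (Suc m)) = Polynomial.smult (real (Suc m)) (hermite m)"
      using less[of m] Suc by simp
    show ?thesis
    proof (cases m)
      case 0
      then show ?thesis using Suc by (simp add: pderiv_diff pderiv_mult pderiv_pCons)
    next
      case (Suc l)
      have "pderiv (hermite m) = Polynomial.smult (real m) (hermite l)"
        using less[of l] \<open>n = Suc m\<close> Suc by simp
      then have "pderiv (hermite (Suc (Suc m))) = hermite (Suc m)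
          + Polynomial.smult (real (Suc m)) ([:0, 1:] * hermite m - Polynomial.smult (real m) (hermite l))"
        by (simp add: pderiv_diff pderiv_mult pderiv_pCons pderiv_smult IH smult_diff_right)
      also have "[:0, 1:] * hermite m - Polynomial.smult (real m) (hermite l) = hermite (Suc m)"
        using Suc by simp
      also have "hermite (Suc m) + Polynomial.smult (real (Suc m)) (hermite (Suc m))
          = Polynomial.smult (1 + real (Suc m)) (hermite (Suc m))"
        by (simp only: smult_add_left smult_1_left)
      finally show ?thesis unfolding \<open>n = Suc m\<close> of_nat_Suc[of "Suc m"] .
    qed
  qed
qed

lemma integrable_std_normal_poly: "integrable lborel (\<lambda>x. std_normal_density x * poly p x)"
proof -
  have "integrable lborel (\<lambda>x. \<Sum>i\<le>degree p. coeff p i * (std_normal_density x * x ^ i))"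
    using integrable_std_normal_moment by (intro Bochner_Integration.integrable_sum integrable_mult_right) simp
  then show ?thesis by (simp add: poly_altdef sum_distrib_left mult_ac)
qed

definition gauss_expect :: "real poly \<Rightarrow> real" where
  "gauss_expect p = (\<integral>x. std_normal_density x * poly p x \<partial>lborel)"

lemma gauss_expect_diff: "gauss_expect (p - q) = gauss_expect p - gauss_expect q"
  using integrable_std_normal_poly[of p] integrable_std_normal_poly[of q]
  by (simp add: gauss_expect_def right_diff_distrib)

lemma gauss_expect_smult: "gauss_expect (Polynomial.smult c p) = c * gauss_expect p"
  by (simp add: gauss_expect_def mult.left_commute)

lemma gauss_expect_sum: "gauss_expect (\<Sum>i\<in>A. p i) = (\<Sum>i\<in>A. gauss_expect (p i))"
  using integrable_std_normal_poly by (simp add: gauss_expect_def poly_sum sum_distrib_left)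

text \<open>For even \<open>n\<close> both sides are 0: odd moments vanish, and at
  \<open>n = 0\<close> the factor \<open>real n\<close> covers the truncated exponent. For odd
  \<open>n\<close> the closed formula for even moments applies.\<close>

lemma gauss_expect_moment_Suc: "gauss_expect (monom 1 (Suc n)) = real n * gauss_expect (monom 1 (n - 1))"
proof (cases "even n")
  case True
  then obtain k where k: "n = 2 * k" by (elim evenE)
  have odd: "gauss_expect (monom 1 (2 * j + 1)) = 0" for j
    using integral_std_normal_moment_odd[of j] by (simp add: gauss_expect_def poly_monom)
  show ?thesis
  proof (cases k)
    case 0
    then show ?thesis using odd[of 0] k by simp
  next
    case (Suc j)
    then have "n - 1 = 2 * j + 1" using k by simp
    then show ?thesis using odd[of j] odd[of k] k by simp
  qed
next
  case False
  then obtain k where k: "n = 2 * k + 1" by (elim oddE)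
  have ev: "gauss_expect (monom 1 (2 * j)) = fact (2 * j) / (2 ^ j * fact j)" for j
    using integral_std_normal_moment_even[of j] by (simp add: gauss_expect_def poly_monom)
  have "gauss_expect (monom 1 (2 * Suc k)) = real n * gauss_expect (monom 1 (2 * k))"
    unfolding ev k by (simp add: divide_simps)
  then show ?thesis using k by simp
qed

lemma pderiv_sum: "pderiv (\<Sum>i\<in>A. p i) = (\<Sum>i\<in>A. pderiv (p i))"
  by (induction A rule: infinite_finite_induct) (auto simp: pderiv_add)

text \<open>Gaussian integration by parts; by linearity it reduces to the moment recursion on
  monomials.\<close>

lemma gauss_expect_by_parts: "gauss_expect ([:0, 1:] * p) = gauss_expect (pderiv p)"
proof -
  have p: "p = (\<Sum>i\<le>degree p. Polynomial.smult (coeff p i) (monom 1 i))"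
    by (simp add: smult_monom poly_as_sum_of_monoms)
  have m: "[:0, 1:] * monom 1 i = monom (1::real) (Suc i)" for i
    by (simp add: monom_Suc)
  have "gauss_expect ([:0, 1:] * p) = (\<Sum>i\<le>degree p. coeff p i * gauss_expect (monom 1 (Suc i)))"
    by (subst p) (simp only: sum_distrib_left mult_smult_right m gauss_expect_sum gauss_expect_smult)
  also have "\<dots> = (\<Sum>i\<le>degree p. coeff p i * gauss_expect (Polynomial.smult (real i) (monom 1 (i - 1))))"
    by (simp only: gauss_expect_moment_Suc gauss_expect_smult)
  also have "\<dots> = gauss_expect (pderiv p)"
  proof -
    have "pderiv p = (\<Sum>i\<le>degree p. Polynomial.smult (coeff p i) (Polynomial.smult (real i) (monom 1 (i - 1))))"
      by (subst p) (simp add: pderiv_sum pderiv_smult pderiv_monom smult_monom mult.commute)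
    then show ?thesis by (simp only: gauss_expect_sum gauss_expect_smult)
  qed
  finally show ?thesis .
qed

text \<open>From degree two on, integration by parts turns the first term of the recurrence into the
  derivative of the preceding polynomial, which the second term cancels by the Appell
  property.\<close>

lemma gauss_expect_hermite: "gauss_expect (hermite n) = (if n = 0 then 1 else 0)"
proof (cases n rule: hermite.cases)
  case 1
  then show ?thesis using integral_std_normal_moment_even[of 0] by (simp add: gauss_expect_def)
next
  case 2
  then show ?thesis using gauss_expect_moment_Suc[of 0] by (simp add: monom_Suc monom_0)
next
  case (3 m)
  then show ?thesis
    by (simp only: hermite.simps gauss_expect_diff gauss_expect_by_parts pderiv_hermite gauss_expect_smult) simp
qed

definition nhermite :: "nat \<Rightarrow> real \<Rightarrow> real" where
  "nhermite n x = poly (hermite n) x / sqrt (fact n)"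

text \<open>Dividing by \<open>sqrt (fact n)\<close> makes the coefficients
  \<open>sqrt (n + 1)\<close> and \<open>sqrt n\<close>, exactly those of \<open>annih\<close> and
  \<open>creat\<close>. At \<open>n = 0\<close> the second coefficient is 0, so \<open>n - 1\<close>
  does no harm.\<close>

lemma nhermite_recurrence:
  "x * nhermite n x = sqrt (real (Suc n)) * nhermite (Suc n) x + sqrt (real n) * nhermite (n - 1) x"
proof -
  have s: "sqrt (fact (Suc m)) = sqrt (real (Suc m)) * sqrt (fact m)" for m
    by (simp add: real_sqrt_mult[symmetric] del: of_nat_Suc)
  have pos: "sqrt (real (Suc m)) > 0" for m by simp
  have one: "sqrt (real (Suc n)) * nhermite (Suc n) x = poly (hermite (Suc n)) x / sqrt (fact n)"
    unfolding nhermite_def s using pos[of n] by (simp del: of_nat_Suc)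
  show ?thesis
  proof (cases n)
    case 0
    then show ?thesis by (simp add: nhermite_def)
  next
    case (Suc m)
    have "sqrt (real n) * nhermite (n - 1) x = real n * poly (hermite m) x / sqrt (fact n)"
      unfolding Suc nhermite_def s using pos[of m] real_sqrt_mult_self[of "real (Suc m)"]
      by (simp add: field_simps del: of_nat_Suc real_sqrt_mult_self)
    then show ?thesis
      unfolding one by (simp add: nhermite_def Suc diff_divide_distrib del: fact_Suc of_nat_Suc)
  qed
qed

lemma nhermite_measurable [measurable]: "nhermite n \<in> borel_measurable borel"
  unfolding nhermite_def by (intro borel_measurable_continuous_onI continuous_intros) auto

section \<open>Fock vectors realized as polynomials in the Gaussian entries\<close>

locale gaussian_fock = fock_space N D + prob_space M
  for N D :: nat and M :: "'w measure" +
  fixes Z :: "bool \<times> site \<Rightarrow> 'w \<Rightarrow> real"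
  assumes indep: "indep_vars (\<lambda>_. borel) Z UNIV"
    and normal: "\<And>p. distributed M lborel (Z p) std_normal_density"
begin

definition modes :: "(bool \<times> site) set" where
  "modes = UNIV \<times> sites"

definition hfun :: "(bool \<times> site) multiset \<Rightarrow> 'w \<Rightarrow> real" where
  "hfun \<alpha> \<omega> = (\<Prod>p\<in>modes. nhermite (count \<alpha> p) (Z p \<omega>))"

definition realize :: "(nat \<Rightarrow> fock) \<Rightarrow> 'w \<Rightarrow> nat \<Rightarrow> complex" where
  "realize f \<omega> i = (\<Sum>\<alpha>\<in>states D. f i \<alpha> * complex_of_real (hfun \<alpha> \<omega>))"

text \<open>The Ginibre matrix for \<open>t\<close> true, its conjugate transpose for
  \<open>t\<close> false.\<close>

definition entry :: "bool \<Rightarrow> 'w \<Rightarrow> nat \<Rightarrow> nat \<Rightarrow> complex" where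
  "entry t \<omega> i j = (Z (True, site_of t i j) \<omega> + phase t * Z (False, site_of t i j) \<omega>)
     / complex_of_real (sqrt 2) / complex_of_real (sqrt (real N))"

lemma nhermite_expectation:
  "integrable M (\<lambda>\<omega>. nhermite n (Z p \<omega>))"
  "expectation (\<lambda>\<omega>. nhermite n (Z p \<omega>)) = (if n = 0 then 1 else 0)"
proof -
  have eq: "std_normal_density x * nhermite n x = std_normal_density x * poly (hermite n) x / sqrt (fact n)" for x
    by (simp add: nhermite_def)
  have "integrable lborel (\<lambda>x. std_normal_density x * nhermite n x)"
    unfolding eq using integrable_std_normal_poly by (intro integrable_divide) auto
  then show "integrable M (\<lambda>\<omega>. nhermite n (Z p \<omega>))"
    using distributed_integrable[OF normal[of p], of "nhermite n"] by simp
  have "expectation (\<lambda>\<omega>. nhermite n (Z p \<omega>)) = (\<integral>x. std_normal_density x * nhermite n x \<partial>lborel)"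
    using distributed_integral[OF normal[of p], of "nhermite n"] by simp
  also have "\<dots> = gauss_expect (hermite n) / sqrt (fact n)"
    unfolding eq gauss_expect_def by simp
  finally show "expectation (\<lambda>\<omega>. nhermite n (Z p \<omega>)) = (if n = 0 then 1 else 0)"
    by (simp add: gauss_expect_hermite)
qed

lemma finite_modes [simp]: "finite modes"
  by (simp add: modes_def)

text \<open>Independence factors the expectation over the modes, and a factor of positive degree has
  mean 0. Membership in \<open>states n\<close> places every mode of \<open>\<alpha>\<close> in the
  range of the product.\<close>

lemma hfun_expectation:
  "integrable M (hfun \<alpha>)"
  "\<alpha> \<in> states n \<Longrightarrow> expectation (hfun \<alpha>) = (if \<alpha> = {#} then 1 else 0)"
proof -
  have ind: "indep_vars (\<lambda>_. borel) (\<lambda>p \<omega>. nhermite (count \<alpha> p) (Z p \<omega>)) modes"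
    using indep_vars_compose2[OF indep_vars_subset[OF indep, of modes], of "\<lambda>p. nhermite (count \<alpha> p)" "\<lambda>_. borel"]
    by simp
  show "integrable M (hfun \<alpha>)"
    unfolding hfun_def[abs_def] using nhermite_expectation(1) by (intro indep_vars_integrable ind) auto
  assume \<alpha>: "\<alpha> \<in> states n"
  have "expectation (hfun \<alpha>) = (\<Prod>p\<in>modes. expectation (\<lambda>\<omega>. nhermite (count \<alpha> p) (Z p \<omega>)))"
    unfolding hfun_def[abs_def] using nhermite_expectation(1) by (intro indep_vars_lebesgue_integral ind) auto
  also have "\<dots> = (\<Prod>p\<in>modes. if count \<alpha> p = 0 then 1 else 0)"
    by (simp only: nhermite_expectation(2))
  also have "\<dots> = (if \<alpha> = {#} then 1 else 0)"
  proof (cases "\<alpha> = {#}")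
    case False
    then obtain p where "p \<in># \<alpha>" by (meson multiset_nonemptyE)
    then have "p \<in> modes" "count \<alpha> p \<noteq> 0" using \<alpha> by (auto simp: states_def modes_def)
    then have "(\<Prod>p\<in>modes. if count \<alpha> p = 0 then 1 else 0) = (0 :: real)"
      by (intro prod_zero) auto
    then show ?thesis using False by simp
  qed simp
  finally show "expectation (hfun \<alpha>) = (if \<alpha> = {#} then 1 else 0)" .
qed

lemma hfun_mult:
  assumes "p \<in> modes"
  shows "Z p \<omega> * hfun \<alpha> \<omega>
    = sqrt (real (count \<alpha> p + 1)) * hfun (add_mset p \<alpha>) \<omega> + sqrt (real (count \<alpha> p)) * hfun (\<alpha> - {#p#}) \<omega>"
proof -
  define R where "R = (\<Prod>q\<in>modes - {p}. nhermite (count \<alpha> q) (Z q \<omega>))"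
  have h: "hfun \<beta> \<omega> = nhermite (count \<beta> p) (Z p \<omega>) * R"
    if "\<And>q. q \<noteq> p \<Longrightarrow> count \<beta> q = count \<alpha> q" for \<beta>
    unfolding hfun_def R_def using assms that by (subst prod.remove[of _ p]) auto
  have "hfun \<alpha> \<omega> = nhermite (count \<alpha> p) (Z p \<omega>) * R"
    "hfun (add_mset p \<alpha>) \<omega> = nhermite (Suc (count \<alpha> p)) (Z p \<omega>) * R"
    "hfun (\<alpha> - {#p#}) \<omega> = nhermite (count \<alpha> p - 1) (Z p \<omega>) * R"
    by (simp_all add: h)
  then show ?thesis using nhermite_recurrence[of "Z p \<omega>" "count \<alpha> p"] by (simp add: algebra_simps)
qed

text \<open>The three-term recurrence acts on the basis functions; transposing it to the
  coefficients exchanges \<open>annih\<close> and \<open>creat\<close>. Since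
  \<open>Suc n \<le> D\<close>, the coefficients vanish at the cutoff and both shifts are
  exact.\<close>

lemma realize_mult:
  assumes p: "p \<in> modes" and \<psi>: "deg_le n \<psi>" and n: "Suc n \<le> D"
  shows "Z p \<omega> * (\<Sum>\<alpha>\<in>states D. \<psi> \<alpha> * complex_of_real (hfun \<alpha> \<omega>))
    = (\<Sum>\<alpha>\<in>states D. (creat p \<psi> \<alpha> + annih p \<psi> \<alpha>) * complex_of_real (hfun \<alpha> \<omega>))"
proof -
  let ?h = "\<lambda>\<alpha>. complex_of_real (hfun \<alpha> \<omega>)"
  have sp: "snd p \<in> sites" using p by (auto simp: modes_def)
  have top: "\<psi> \<alpha> = 0" if "size \<alpha> \<ge> D" for \<alpha>
    using \<psi> n that by (auto simp: deg_le_def states_def)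
  have eq: "Z p \<omega> * ?h \<alpha> = annih p ?h \<alpha> + creat p ?h \<alpha>" for \<alpha>
    unfolding annih_def creat_def of_real_mult[symmetric] of_real_add[symmetric] using hfun_mult[OF p] by simp
  have "Z p \<omega> * (\<Sum>\<alpha>\<in>states D. \<psi> \<alpha> * ?h \<alpha>) = (\<Sum>\<alpha>\<in>states D. \<psi> \<alpha> * (Z p \<omega> * ?h \<alpha>))"
    by (simp add: sum_distrib_left mult_ac)
  also have "\<dots> = (\<Sum>\<alpha>\<in>states D. annih p ?h \<alpha> * \<psi> \<alpha>) + (\<Sum>\<alpha>\<in>states D. \<psi> \<alpha> * creat p ?h \<alpha>)"
    unfolding eq by (simp add: ring_distribs sum.distrib mult.commute)
  also have "(\<Sum>\<alpha>\<in>states D. annih p ?h \<alpha> * \<psi> \<alpha>) = (\<Sum>\<alpha>\<in>states D. ?h \<alpha> * creat p \<psi> \<alpha>)"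
    by (rule sum_annih_shift[OF sp]) (simp add: top)
  also have "(\<Sum>\<alpha>\<in>states D. \<psi> \<alpha> * creat p ?h \<alpha>) = (\<Sum>\<alpha>\<in>states D. annih p \<psi> \<alpha> * ?h \<alpha>)"
    by (rule sum_annih_shift[OF sp, symmetric]) (simp add: top)
  finally show ?thesis by (simp add: ring_distribs sum.distrib mult.commute)
qed

definition act :: "bool \<Rightarrow> 'w \<Rightarrow> (nat \<Rightarrow> complex) \<Rightarrow> nat \<Rightarrow> complex" where
  "act t \<omega> v i = (\<Sum>j<N. entry t \<omega> i j * v j)"

text \<open>This links the two sides: the field operator on coefficients is multiplication by the
  random matrix on their realizations.\<close>

lemma realize_field_op:
  assumes f: "vdeg n f" and n: "Suc n \<le> D" and i: "i < N"
  shows "realize (field_op t f) \<omega> i = act t \<omega> (realize f \<omega>) i"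
proof -
  define S where "S \<psi> = (\<Sum>\<alpha>\<in>states D. \<psi> \<alpha> * complex_of_real (hfun \<alpha> \<omega>))" for \<psi> :: fock
  have S_div: "S (\<lambda>\<alpha>. \<psi> \<alpha> / c) = S \<psi> / c" for \<psi> c
    by (simp add: S_def sum_divide_distrib)
  have S_add: "S (\<lambda>\<alpha>. \<psi> \<alpha> + \<phi> \<alpha>) = S \<psi> + S \<phi>" for \<psi> \<phi>
    by (simp add: S_def ring_distribs sum.distrib)
  have S_mult: "S (\<lambda>\<alpha>. c * \<psi> \<alpha>) = c * S \<psi>" for \<psi> c
    by (simp add: S_def sum_distrib_left mult_ac)
  have S_sum: "S (\<lambda>\<alpha>. \<Sum>j<N. h j \<alpha>) = (\<Sum>j<N. S (h j))" for h
    unfolding S_def sum_distrib_right by (rule sum.swap)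
  have Zm: "S (creat p (f j)) + S (annih p (f j)) = Z p \<omega> * S (f j)" if "j < N" "snd p \<in> sites" for p j
    using realize_mult[of p n "f j" \<omega>] f n that by (cases p) (simp add: S_def vdeg_def modes_def ring_distribs sum.distrib)
  have "realize (field_op t f) \<omega> i = S (\<lambda>\<alpha>. up t f i \<alpha> + down t f i \<alpha>)"
    by (simp add: realize_def S_def field_op_def)
  also have "\<dots> = (\<Sum>j<N. (S (ccreat (phase t) (site_of t i j) (f j)) + S (cannih (phase t) (site_of t i j) (f j)))
      / complex_of_real (sqrt (real N)))"
    by (simp add: S_add up_def down_def S_div S_sum sum_divide_distrib sum.distrib add_divide_distrib)
  also have "\<dots> = (\<Sum>j<N. entry t \<omega> i j * S (f j))"
  proof (rule sum.cong[OF refl])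
    fix j assume "j \<in> {..<N}"
    then have j: "j < N" by simp
    let ?x = "(True, site_of t i j)" and ?y = "(False, site_of t i j)"
    have "S (ccreat (phase t) (site_of t i j) (f j)) + S (cannih (phase t) (site_of t i j) (f j))
        = ((S (creat ?x (f j)) + S (annih ?x (f j))) + phase t * (S (creat ?y (f j)) + S (annih ?y (f j))))
          / complex_of_real (sqrt 2)"
      unfolding ccreat_def cannih_def S_div S_add S_mult by (simp add: field_simps)
    also have "\<dots> = (Z ?x \<omega> + phase t * Z ?y \<omega>) / complex_of_real (sqrt 2) * S (f j)"
      by (subst (1 2) Zm) (use j i site_of_sites in \<open>simp_all add: field_simps\<close>)
    finally show "(S (ccreat (phase t) (site_of t i j) (f j)) + S (cannih (phase t) (site_of t i j) (f j)))
      / complex_of_real (sqrt (real N)) = entry t \<omega> i j * S (f j)"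
      by (simp add: entry_def)
  qed
  finally show ?thesis by (simp add: act_def realize_def S_def)
qed

lemma act_cong: "(\<And>j. j < N \<Longrightarrow> v j = w j) \<Longrightarrow> act t \<omega> v i = act t \<omega> w i"
  by (simp add: act_def)

lemma realize_field_op_pow:
  assumes "vdeg n f" "n + k \<le> D" "i < N"
  shows "realize ((field_op t ^^ k) f) \<omega> i = (act t \<omega> ^^ k) (realize f \<omega>) i"
  using assms(2,3)
proof (induction k arbitrary: i)
  case (Suc k)
  have "realize ((field_op t ^^ Suc k) f) \<omega> i = act t \<omega> (realize ((field_op t ^^ k) f) \<omega>) i"
    using realize_field_op[OF vdeg_field_op_pow[OF assms(1)]] Suc.prems by simp
  also have "\<dots> = act t \<omega> ((act t \<omega> ^^ k) (realize f \<omega>)) i"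
    using Suc by (intro act_cong) simp
  finally show ?case by simp
qed simp

section \<open>The Gram matrix of the k-th power and its expected trace\<close>

definition gram_op :: "nat \<Rightarrow> (nat \<Rightarrow> fock) \<Rightarrow> nat \<Rightarrow> fock" where
  "gram_op k f = (field_op False ^^ k) ((field_op True ^^ k) f)"

text \<open>This is \<open>(G\<^sup>k)\<^sup>* G\<^sup>k\<close>, the adjoint of a power being the
  power of the adjoint.\<close>

definition gram :: "nat \<Rightarrow> 'w \<Rightarrow> (nat \<Rightarrow> complex) \<Rightarrow> nat \<Rightarrow> complex" where
  "gram k \<omega> v = (act False \<omega> ^^ k) ((act True \<omega> ^^ k) v)"

lemma act_pow_cong:
  "(\<And>j. j < N \<Longrightarrow> v j = w j) \<Longrightarrow> i < N \<Longrightarrow> (act t \<omega> ^^ k) v i = (act t \<omega> ^^ k) w i"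
  by (induction k arbitrary: i) (auto intro: act_cong)

lemma gram_cong:
  "(\<And>j. j < N \<Longrightarrow> v j = w j) \<Longrightarrow> i < N \<Longrightarrow> gram k \<omega> v i = gram k \<omega> w i"
  unfolding gram_def by (intro act_pow_cong)

lemma vdeg_gram_op_pow: "vdeg n f \<Longrightarrow> vdeg (n + 2 * k * m) ((gram_op k ^^ m) f)"
proof (induction m)
  case (Suc m)
  have "vdeg (n + 2 * k * m + k + k) (gram_op k ((gram_op k ^^ m) f))"
    unfolding gram_op_def using Suc by (intro vdeg_field_op_pow) (simp add: gram_op_def[abs_def])
  then show ?case by (simp add: algebra_simps)
qed simp

lemma gain_nonneg: "0 \<le> gain k"
proof -
  have "0 \<le> excess s \<tau> k" if "0 \<le> s" "0 \<le> \<tau>" for s \<tau>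
    using that by (induction k) auto
  then show ?thesis by (simp add: gain_def)
qed

lemma vnorm_gram_op_pow:
  assumes "vdeg n f" "Suc n + 2 * k * m \<le> D"
  shows "vnorm ((gram_op k ^^ m) f) \<le> gain k ^ (2 * m) * vnorm f"
  using assms(2)
proof (induction m)
  case (Suc m)
  let ?g = "(gram_op k ^^ m) f"
  have deg: "vdeg (n + 2 * k * m) ?g" by (rule vdeg_gram_op_pow[OF assms(1)])
  have "vnorm (gram_op k ?g) \<le> gain k * vnorm ((field_op True ^^ k) ?g)"
    unfolding gram_op_def[of k ?g] using Suc.prems
    by (intro vnorm_field_op_pow[OF vdeg_field_op_pow[OF deg]]) (simp add: algebra_simps)
  also have "\<dots> \<le> gain k * (gain k * vnorm ?g)"
    using Suc.prems by (intro mult_left_mono vnorm_field_op_pow[OF deg] gain_nonneg) (simp add: algebra_simps)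
  also have "\<dots> \<le> gain k * (gain k * (gain k ^ (2 * m) * vnorm f))"
    using Suc by (intro mult_left_mono gain_nonneg) simp
  finally show ?case by (simp add: mult.assoc)
qed simp

lemma realize_gram_op_pow:
  assumes "vdeg n f" "n + 2 * k * m \<le> D" "i < N"
  shows "realize ((gram_op k ^^ m) f) \<omega> i = (gram k \<omega> ^^ m) (realize f \<omega>) i"
  using assms(2,3)
proof (induction m arbitrary: i)
  case (Suc m)
  let ?g = "(gram_op k ^^ m) f"
  have deg: "vdeg (n + 2 * k * m) ?g" by (rule vdeg_gram_op_pow[OF assms(1)])
  have "realize (gram_op k ?g) \<omega> i = (act False \<omega> ^^ k) (realize ((field_op True ^^ k) ?g) \<omega>) i"
    unfolding gram_op_def[of k ?g] using Suc.prems
    by (intro realize_field_op_pow[OF vdeg_field_op_pow[OF deg]]) (simp_all add: algebra_simps)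
  also have "\<dots> = gram k \<omega> (realize ?g \<omega>) i"
    unfolding gram_def using Suc.prems
    by (intro act_pow_cong realize_field_op_pow[OF deg]) (simp_all add: algebra_simps)
  also have "\<dots> = gram k \<omega> ((gram k \<omega> ^^ m) (realize f \<omega>)) i"
    using Suc by (intro gram_cong) simp_all
  finally show ?case by simp
qed simp

definition unit :: "nat \<Rightarrow> nat \<Rightarrow> complex" where
  "unit a j = (if j = a then 1 else 0)"

definition gram_trace :: "nat \<Rightarrow> nat \<Rightarrow> 'w \<Rightarrow> complex" where
  "gram_trace k m \<omega> = (\<Sum>a<N. (gram k \<omega> ^^ m) (unit a) a)"

lemma gram_pow_cong:
  "(\<And>j. j < N \<Longrightarrow> v j = w j) \<Longrightarrow> i < N \<Longrightarrow> (gram k \<omega> ^^ m) v i = (gram k \<omega> ^^ m) w i"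
  by (induction m arbitrary: i) (auto intro: gram_cong)

text \<open>Each diagonal entry is the realization of a Fock vector obtained from a vacuum vector by
  \<open>m\<close> applications of \<open>gram_op k\<close>. Its expectation is its vacuum
  coefficient, at most its norm. Each application raises the degree by up to \<open>2 * k\<close>,
  whence the condition on \<open>D\<close>.\<close>

lemma gram_trace_expectation:
  assumes "2 * k * m < D"
  shows "integrable M (gram_trace k m)"
    and "cmod (expectation (gram_trace k m)) \<le> real N * gain k ^ (2 * m)"
proof -
  \<comment> \<open>The vacuum in coordinate \<open>a\<close>; its realization is the deterministic
    vector \<open>unit a\<close>.\<close>
  define e :: "nat \<Rightarrow> nat \<Rightarrow> fock"
    where "e a = (\<lambda>i \<alpha>. if i = a \<and> \<alpha> = {#} then 1 else 0)" for a
  have deg: "vdeg 0 (e a)" for a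
    by (simp add: vdeg_def deg_le_def e_def states_def)
  have nrm: "vnorm (e a) = 1" if "a < N" for a
  proof -
    have "(cmod (e a i \<alpha>))\<^sup>2 = (if i = a then if \<alpha> = {#} then 1 else 0 else 0)" for i \<alpha>
      by (simp add: e_def)
    then have "norm_sq (e a i) = (if i = a then 1 else 0)" for i
      by (simp add: norm_sq_def) (simp add: states_def)
    then show ?thesis using that by (simp add: vnorm_def)
  qed
  have rl: "realize (e a) \<omega> i = unit a i" for a \<omega> i
  proof -
    have "e a i \<alpha> * complex_of_real (hfun \<alpha> \<omega>) = (if \<alpha> = {#} then if i = a then 1 else 0 else 0)" for \<alpha>
      by (simp add: e_def hfun_def nhermite_def)
    then show ?thesis by (simp add: realize_def unit_def) (simp add: states_def)
  qed
  have tr: "gram_trace k m = (\<lambda>\<omega>. \<Sum>a<N. realize ((gram_op k ^^ m) (e a)) \<omega> a)"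
  proof
    fix \<omega>
    have "realize ((gram_op k ^^ m) (e a)) \<omega> a = (gram k \<omega> ^^ m) (unit a) a" if "a < N" for a
    proof -
      have "realize ((gram_op k ^^ m) (e a)) \<omega> a = (gram k \<omega> ^^ m) (realize (e a) \<omega>) a"
        using assms by (intro realize_gram_op_pow[OF deg] that) simp
      then show ?thesis using gram_pow_cong[of "realize (e a) \<omega>" "unit a" a] that by (simp add: rl)
    qed
    then show "gram_trace k m \<omega> = (\<Sum>a<N. realize ((gram_op k ^^ m) (e a)) \<omega> a)"
      by (simp add: gram_trace_def)
  qed
  have int: "integrable M (\<lambda>\<omega>. f a \<alpha> * complex_of_real (hfun \<alpha> \<omega>))" for f :: "nat \<Rightarrow> fock" and a \<alpha>
    using hfun_expectation(1)[of \<alpha>] by (intro integrable_mult_right integrable_of_real) auto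
  then have int2: "integrable M (\<lambda>\<omega>. realize f \<omega> a)" for f a
    unfolding realize_def by (intro Bochner_Integration.integrable_sum) auto
  then show "integrable M (gram_trace k m)"
    unfolding tr by (intro Bochner_Integration.integrable_sum) auto
  have ex: "expectation (\<lambda>\<omega>. realize f \<omega> a) = f a {#}" for f a
  proof -
    have "expectation (\<lambda>\<omega>. realize f \<omega> a)
        = (\<Sum>\<alpha>\<in>states D. expectation (\<lambda>\<omega>. f a \<alpha> * complex_of_real (hfun \<alpha> \<omega>)))"
      unfolding realize_def by (intro Bochner_Integration.integral_sum int)
    also have "\<dots> = (\<Sum>\<alpha>\<in>states D. f a \<alpha> * (if \<alpha> = {#} then 1 else 0))"
      using hfun_expectation(2) by (intro sum.cong refl) (simp add: integral_complex_of_real)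
    also have "\<dots> = f a {#}" by (simp add: if_distrib cong: if_cong) (simp add: states_def)
    finally show ?thesis .
  qed
  have "cmod (expectation (gram_trace k m)) = cmod (\<Sum>a<N. (gram_op k ^^ m) (e a) a {#})"
    unfolding tr using int2 by (subst Bochner_Integration.integral_sum) (auto simp: ex)
  also have "\<dots> \<le> (\<Sum>a<N. gain k ^ (2 * m))"
  proof (rule sum_norm_le)
    fix a assume "a \<in> {..<N}"
    then have a: "a < N" by simp
    let ?g = "(gram_op k ^^ m) (e a)"
    have "{#} \<in> states D" by (simp add: states_def)
    then have "cmod (?g a {#}) \<le> vnorm ?g"
      unfolding vnorm_L2 using a member_le_L2_set[of "{..<N} \<times> states D" "(a, {#})" "\<lambda>(i, \<alpha>). cmod (?g i \<alpha>)"]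
      by simp
    also have "\<dots> \<le> gain k ^ (2 * m)"
      using vnorm_gram_op_pow[OF deg, of k m a] assms nrm[OF a] by simp
    finally show "cmod (?g a {#}) \<le> gain k ^ (2 * m)" .
  qed
  finally show "cmod (expectation (gram_trace k m)) \<le> real N * gain k ^ (2 * m)" by simp
qed

end


section \<open>From traces to operator norms\<close>

definition sqsum :: "nat \<Rightarrow> (nat \<Rightarrow> complex) \<Rightarrow> real" where
  "sqsum N v = (\<Sum>i<N. (cmod (v i))\<^sup>2)"

definition dot :: "nat \<Rightarrow> (nat \<Rightarrow> complex) \<Rightarrow> (nat \<Rightarrow> complex) \<Rightarrow> complex" where
  "dot N u v = (\<Sum>i<N. u i * cnj (v i))"

lemma sqsum_nonneg [simp]: "0 \<le> sqsum N v"
  by (simp add: sqsum_def sum_nonneg)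

lemma dot_self: "dot N v v = of_real (sqsum N v)"
  by (simp add: dot_def sqsum_def complex_norm_square[symmetric])

lemma cmod_sum_mult_sq_le:
  fixes u v :: "nat \<Rightarrow> complex"
  shows "(cmod (\<Sum>i<N. u i * v i))\<^sup>2 \<le> (\<Sum>i<N. (cmod (u i))\<^sup>2) * (\<Sum>i<N. (cmod (v i))\<^sup>2)"
proof -
  have "cmod (\<Sum>i<N. u i * v i) \<le> (\<Sum>i<N. cmod (u i) * cmod (v i))"
    using norm_sum[of "\<lambda>i. u i * v i" "{..<N}"] by (simp add: norm_mult)
  then have "(cmod (\<Sum>i<N. u i * v i))\<^sup>2 \<le> (\<Sum>i<N. cmod (u i) * cmod (v i))\<^sup>2"
    by (rule power_mono) simp
  also have "\<dots> \<le> (\<Sum>i<N. (cmod (u i))\<^sup>2) * (\<Sum>i<N. (cmod (v i))\<^sup>2)"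
    by (rule Cauchy_Schwarz_ineq_sum)
  finally show ?thesis .
qed

lemma cmod_dot_sq_le: "(cmod (dot N u v))\<^sup>2 \<le> sqsum N u * sqsum N v"
  using cmod_sum_mult_sq_le[of u "\<lambda>i. cnj (v i)" N] by (simp add: dot_def sqsum_def)

context gaussian_fock
begin

lemma entry_adjoint: "cnj (entry t \<omega> i j) = entry (\<not> t) \<omega> j i"
  by (simp add: entry_def site_of_not)

lemma dot_act: "dot N (act t \<omega> u) v = dot N u (act (\<not> t) \<omega> v)"
proof -
  have "dot N (act t \<omega> u) v = (\<Sum>i<N. \<Sum>j<N. entry t \<omega> i j * u j * cnj (v i))"
    by (simp add: dot_def act_def sum_distrib_right)
  also have "\<dots> = (\<Sum>j<N. \<Sum>i<N. entry t \<omega> i j * u j * cnj (v i))"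
    by (rule sum.swap)
  also have "\<dots> = dot N u (act (\<not> t) \<omega> v)"
    by (simp add: dot_def act_def sum_distrib_left entry_adjoint mult_ac)
  finally show ?thesis .
qed

lemma dot_act_pow: "dot N ((act t \<omega> ^^ k) u) v = dot N u ((act (\<not> t) \<omega> ^^ k) v)"
  by (induction k arbitrary: v) (simp_all add: dot_act, simp add: funpow_swap1)

lemma dot_gram: "dot N (gram k \<omega> u) v = dot N u (gram k \<omega> v)"
  by (simp add: gram_def dot_act_pow)

lemma dot_gram_pow: "dot N ((gram k \<omega> ^^ m) u) v = dot N u ((gram k \<omega> ^^ m) v)"
  by (induction m arbitrary: v) (simp_all add: dot_gram, simp add: funpow_swap1)

lemma sqsum_gram_pow: "of_real (sqsum N ((gram k \<omega> ^^ m) v)) = dot N ((gram k \<omega> ^^ (2 * m)) v) v"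
  by (simp add: dot_self[symmetric] dot_gram_pow mult_2 funpow_add)

lemma act_lincomb:
  "act t \<omega> (\<lambda>i. \<Sum>a<n. c a * w a i) = (\<lambda>i. \<Sum>a<n. c a * act t \<omega> (w a) i)"
proof
  fix i
  have "act t \<omega> (\<lambda>i. \<Sum>a<n. c a * w a i) i = (\<Sum>j<N. \<Sum>a<n. c a * (entry t \<omega> i j * w a j))"
    by (simp add: act_def sum_distrib_left mult_ac)
  also have "\<dots> = (\<Sum>a<n. \<Sum>j<N. c a * (entry t \<omega> i j * w a j))"
    by (rule sum.swap)
  finally show "act t \<omega> (\<lambda>i. \<Sum>a<n. c a * w a i) i = (\<Sum>a<n. c a * act t \<omega> (w a) i)"
    by (simp add: act_def sum_distrib_left)
qed

lemma act_pow_lincomb: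
  "(act t \<omega> ^^ k) (\<lambda>i. \<Sum>a<n. c a * w a i) = (\<lambda>i. \<Sum>a<n. c a * (act t \<omega> ^^ k) (w a) i)"
  by (induction k) (simp_all add: act_lincomb)

lemma gram_pow_lincomb:
  "(gram k \<omega> ^^ m) (\<lambda>i. \<Sum>a<n. c a * w a i) = (\<lambda>i. \<Sum>a<n. c a * (gram k \<omega> ^^ m) (w a) i)"
  by (induction m) (simp_all add: gram_def act_pow_lincomb)

text \<open>The Hilbert--Schmidt norm dominates the operator norm, and for a self-adjoint
  \<open>T\<close> its square is the trace of \<open>T\<^sup>2\<close>; here \<open>T\<close> is the
  m-th power of the Gram matrix.\<close>

lemma sqsum_gram_pow_le_trace:
  "sqsum N ((gram k \<omega> ^^ m) v) \<le> sqsum N v * Re (gram_trace k (2 * m) \<omega>)"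
proof -
  let ?w = "\<lambda>a. (gram k \<omega> ^^ m) (unit a)"
  have dec: "(gram k \<omega> ^^ m) v i = (\<Sum>a<N. v a * ?w a i)" if "i < N" for i
  proof -
    have "(gram k \<omega> ^^ m) v i = (gram k \<omega> ^^ m) (\<lambda>i. \<Sum>a<N. v a * unit a i) i"
      using that by (intro gram_pow_cong) (auto simp: unit_def if_distrib cong: if_cong)
    then show ?thesis by (simp add: gram_pow_lincomb)
  qed
  have diag: "dot N u (unit a) = u a" if "a < N" for u a
    using that by (simp add: dot_def unit_def if_distrib[of cnj] if_distrib[of "(*) _"] cong: if_cong)
  have "complex_of_real (\<Sum>a<N. sqsum N (?w a)) = gram_trace k (2 * m) \<omega>"
    by (simp add: sqsum_gram_pow diag gram_trace_def)
  then have tr: "(\<Sum>a<N. sqsum N (?w a)) = Re (gram_trace k (2 * m) \<omega>)"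
    by (metis Re_complex_of_real)
  have "sqsum N ((gram k \<omega> ^^ m) v) \<le> (\<Sum>i<N. sqsum N v * (\<Sum>a<N. (cmod (?w a i))\<^sup>2))"
    unfolding sqsum_def[of _ "(gram k \<omega> ^^ m) v"]
    by (intro sum_mono) (simp add: dec cmod_sum_mult_sq_le sqsum_def)
  also have "\<dots> = sqsum N v * (\<Sum>i<N. \<Sum>a<N. (cmod (?w a i))\<^sup>2)"
    by (simp add: sum_distrib_left)
  also have "(\<Sum>i<N. \<Sum>a<N. (cmod (?w a i))\<^sup>2) = (\<Sum>a<N. sqsum N (?w a))"
    unfolding sqsum_def by (rule sum.swap)
  finally show ?thesis by (simp add: tr)
qed

text \<open>Repeated squaring: for a positive semidefinite \<open>T\<close>, Cauchy--Schwarz gives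
  \<open>\<langle>T v, v\<rangle>\<^sup>2 \<le> \<langle>T\<^sup>2 v, v\<rangle> \<parallel>v\<parallel>\<^sup>2\<close>.\<close>

lemma sqsum_act_pow_le_trace:
  "sqsum N ((act True \<omega> ^^ k) v) ^ (2 ^ Suc s) \<le> sqsum N v ^ (2 ^ Suc s) * Re (gram_trace k (2 ^ Suc s) \<omega>)"
proof -
  let ?q = "sqsum N ((act True \<omega> ^^ k) v)" and ?n = "sqsum N v"
  define c where "c s = cmod (dot N ((gram k \<omega> ^^ (2 ^ s)) v) v)" for s
  have c0: "c 0 = ?q"
  proof -
    have "dot N (gram k \<omega> v) v = of_real ?q"
      by (simp add: gram_def dot_act_pow dot_self)
    then show ?thesis by (simp add: c_def)
  qed
  have cS: "c (Suc s) = sqsum N ((gram k \<omega> ^^ (2 ^ s)) v)" for s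
    using sqsum_gram_pow[of "2 ^ s" k \<omega> v] by (simp add: c_def) (metis abs_of_nonneg norm_of_real sqsum_nonneg)
  have step: "(c s)\<^sup>2 \<le> c (Suc s) * ?n" for s
    unfolding cS unfolding c_def by (rule cmod_dot_sq_le)
  \<comment> \<open>Each squaring uses one further factor \<open>?n\<close>, so the exponents follow
    \<open>e \<mapsto> 2 * e + 1\<close> from 0, which gives \<open>2 ^ s - 1\<close>.\<close>
  have main: "?q ^ (2 ^ s) \<le> c s * ?n ^ (2 ^ s - 1)" for s
  proof (induction s)
    case (Suc s)
    have "?q ^ (2 ^ Suc s) = (?q ^ (2 ^ s))\<^sup>2" by (simp add: power_mult[symmetric] mult.commute)
    also have "\<dots> \<le> (c s * ?n ^ (2 ^ s - 1))\<^sup>2" by (intro power_mono Suc) simp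
    also have "\<dots> \<le> (c (Suc s) * ?n) * (?n ^ (2 ^ s - 1))\<^sup>2"
      unfolding power_mult_distrib by (intro mult_right_mono step) simp
    also have "\<dots> = c (Suc s) * ?n ^ (1 + 2 * (2 ^ s - 1))"
      by (simp add: power_mult[symmetric] power_add mult.commute)
    also have "1 + 2 * (2 ^ s - 1) = (2 ^ Suc s - 1 :: nat)"
      using one_le_power[of "2::nat" s] unfolding power_Suc by linarith
    finally show ?case .
  qed (simp add: c0)
  have "?q ^ (2 ^ Suc s) \<le> c (Suc s) * ?n ^ (2 ^ Suc s - 1)" by (rule main)
  also have "\<dots> \<le> (?n * Re (gram_trace k (2 ^ Suc s) \<omega>)) * ?n ^ (2 ^ Suc s - 1)"
    unfolding cS using sqsum_gram_pow_le_trace[of "2 ^ s" k \<omega> v] by (intro mult_right_mono) simp_all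
  also have "\<dots> = ?n ^ (Suc (2 ^ Suc s - 1)) * Re (gram_trace k (2 ^ Suc s) \<omega>)"
    by (simp only: power_Suc mult_ac)
  also have "Suc (2 ^ Suc s - 1) = 2 ^ Suc s" by simp
  finally show ?thesis .
qed

text \<open>Markov's inequality for the trace. The exceptional event is chosen before
  \<open>v\<close>, so outside it the bound holds for all vectors at once; this is what permits a
  right-hand side depending on the matrix.\<close>

lemma act_pow_bound_except:
  assumes \<kappa>: "0 < \<kappa>" and D: "2 * k * 2 ^ Suc s < D"
  obtains A where "A \<in> events" "prob A \<le> real N * (gain k / \<kappa>) ^ (2 * 2 ^ Suc s)"
    "\<And>\<omega> v. \<omega> \<in> space M - A \<Longrightarrow> sqsum N ((act True \<omega> ^^ k) v) \<le> \<kappa>\<^sup>2 * sqsum N v"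
proof -
  define m :: nat where "m = 2 ^ Suc s"
  let ?u = "\<lambda>\<omega>. Re (gram_trace k m \<omega>)"
  define A where "A = {\<omega> \<in> space M. \<kappa> ^ (2 * m) \<le> ?u \<omega>}"
  have int: "integrable M (gram_trace k m)"
    and ex: "cmod (expectation (gram_trace k m)) \<le> real N * gain k ^ (2 * m)"
    using gram_trace_expectation[of k m] D by (simp_all add: m_def)
  have m0: "0 < m" by (simp add: m_def)
  have [measurable]: "gram_trace k m \<in> borel_measurable M" using int by auto
  \<comment> \<open>Markov's inequality needs a nonnegative variable; the trace bound at the unit
    vector \<open>unit 0\<close> supplies this.\<close>
  have nonneg: "0 \<le> ?u \<omega>" for \<omega>
  proof -
    have "0 \<le> sqsum N ((gram k \<omega> ^^ (2 ^ s)) (unit 0))" by simp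
    also have "\<dots> \<le> sqsum N (unit 0) * ?u \<omega>"
      using sqsum_gram_pow_le_trace[of "2 ^ s" k \<omega> "unit 0"] by (simp add: m_def)
    also have "sqsum N (unit 0) = 1"
      using N_pos by (simp add: sqsum_def unit_def if_distrib[of "\<lambda>x. (cmod x)\<^sup>2"] cong: if_cong)
    finally show ?thesis by simp
  qed
  have "A \<in> events" unfolding A_def by measurable
  moreover have "prob A \<le> real N * (gain k / \<kappa>) ^ (2 * m)"
  proof -
    have "prob A \<le> expectation ?u / \<kappa> ^ (2 * m)"
      unfolding A_def using int nonneg \<kappa>
      by (intro integral_Markov_inequality_measure[where A = "{}"]) auto
    also have "expectation ?u = Re (expectation (gram_trace k m))"
      using int by simp
    also have "\<dots> \<le> real N * gain k ^ (2 * m)"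
      using ex complex_Re_le_cmod order_trans by blast
    finally show ?thesis using \<kappa> by (simp add: power_divide divide_right_mono)
  qed
  moreover have "sqsum N ((act True \<omega> ^^ k) v) \<le> \<kappa>\<^sup>2 * sqsum N v" if "\<omega> \<in> space M - A" for \<omega> v
  proof -
    have "sqsum N ((act True \<omega> ^^ k) v) ^ m \<le> sqsum N v ^ m * ?u \<omega>"
      unfolding m_def by (rule sqsum_act_pow_le_trace)
    also have "\<dots> \<le> sqsum N v ^ m * \<kappa> ^ (2 * m)"
      using that by (intro mult_left_mono) (auto simp: A_def)
    also have "\<dots> = (\<kappa>\<^sup>2 * sqsum N v) ^ m"
      by (simp add: power_mult[of \<kappa> 2 m] power_mult_distrib mult.commute[of "sqsum N v ^ m"])
    finally show ?thesis
      using m0 \<kappa> by (subst (asm) power_mono_iff) auto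
  qed
  ultimately show thesis using that by (simp add: m_def)
qed

end

section \<open>The residual of the trial polynomial \<open>(1 - z)\<^sup>k\<close>\<close>

lemma gmres_residual_le_pow:
  fixes G :: "complex mat" and \<sigma> :: real
  assumes G: "G \<in> carrier_mat n n" and b: "b \<in> carrier_vec n" and \<sigma>: "0 \<le> \<sigma>"
  shows "gmres_residual (1\<^sub>m n + complex_of_real \<sigma> \<cdot>\<^sub>m G) b k
    \<le> \<sigma> ^ k * sqrt (sqsum n (((\<lambda>v i. \<Sum>j<n. G $$ (i, j) * v j) ^^ k) (\<lambda>i. b $ i)))"
proof -
  define A where "A = 1\<^sub>m n + complex_of_real \<sigma> \<cdot>\<^sub>m G"
  define g where "g = (\<lambda>(v :: nat \<Rightarrow> complex) i. \<Sum>j<n. G $$ (i, j) * v j)"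
  define w where "w l i = (A ^\<^sub>m l *\<^sub>v b) $ i" for l i
  have A: "A \<in> carrier_mat n n" using G by (simp add: A_def)
  have pow: "A ^\<^sub>m l \<in> carrier_mat n n" for l using A by simp
  \<comment> \<open>Matrix powers grow on the right, whereas the recursion for \<open>w\<close>
    needs the new factor on the left.\<close>
  have comm: "A ^\<^sub>m Suc l = A * A ^\<^sub>m l" for l
    by (induction l) (use A pow in \<open>auto simp: assoc_mult_mat[OF A _ A]\<close>)
  have w_Suc: "w (Suc l) i = w l i + \<sigma> * g (w l) i" if "i < n" for l i
  proof -
    have "A ^\<^sub>m Suc l *\<^sub>v b = A *\<^sub>v (A ^\<^sub>m l *\<^sub>v b)"
      unfolding comm using A pow b by (rule assoc_mult_mat_vec)
    then have "w (Suc l) i = (\<Sum>j<n. A $$ (i, j) * w l j)"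
      using that A pow[of l] b
      by (simp add: w_def scalar_prod_def atLeast0LessThan row_def del: pow_mat.simps)
    also have "\<dots> = (\<Sum>j<n. (if i = j then w l j else 0) + \<sigma> * (G $$ (i, j) * w l j))"
      using that G by (intro sum.cong refl) (auto simp: A_def ring_distribs)
    also have "\<dots> = w l i + \<sigma> * g (w l) i"
      using that by (simp add: sum.distrib g_def sum_distrib_left)
    finally show ?thesis .
  qed
  define q :: "nat \<Rightarrow> complex poly" where "q k = [:1, -1:] ^ k" for k
  have deg: "degree (q k) \<le> k" for k
    using degree_power_le[of "[:1, -1:] :: complex poly" k] by (simp add: q_def)
  have q0: "poly (q k) 0 = 1" for k by (simp add: q_def)
  have qS: "q (Suc k) = q k - pCons 0 (q k)" for k by (simp add: q_def)
  \<comment> \<open>Another factor \<open>1 - z\<close> of the polynomial acts as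
    \<open>I - A\<close>, which is \<open>- \<sigma>\<close> times \<open>G\<close>.\<close>
  have F: "(\<Sum>l\<le>k. coeff (q k) l * w l i) = (- \<sigma>) ^ k * (g ^^ k) (\<lambda>i. b $ i) i" if "i < n" for k i
    using that
  proof (induction k arbitrary: i)
    case 0
    then show ?case using A b by (simp add: q_def w_def)
  next
    case (Suc k)
    have "(\<Sum>l\<le>Suc k. coeff (q (Suc k)) l * w l i)
        = (\<Sum>l\<le>Suc k. coeff (q k) l * w l i) - (\<Sum>l\<le>Suc k. coeff (pCons 0 (q k)) l * w l i)"
      unfolding qS coeff_diff left_diff_distrib sum_subtractf ..
    also have "(\<Sum>l\<le>Suc k. coeff (q k) l * w l i) = (\<Sum>l\<le>k. coeff (q k) l * w l i)"
      using deg[of k] by (simp add: coeff_eq_0)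
    also have "(\<Sum>l\<le>Suc k. coeff (pCons 0 (q k)) l * w l i) = (\<Sum>l\<le>k. coeff (q k) l * w (Suc l) i)"
      by (simp add: sum.atMost_Suc_shift del: sum.atMost_Suc)
    also have "(\<Sum>l\<le>k. coeff (q k) l * w l i) - (\<Sum>l\<le>k. coeff (q k) l * w (Suc l) i)
        = - \<sigma> * (\<Sum>l\<le>k. coeff (q k) l * g (w l) i)"
      using Suc.prems
      by (simp add: w_Suc ring_distribs sum.distrib sum_distrib_left mult_ac sum_negf)
    also have "(\<Sum>l\<le>k. coeff (q k) l * g (w l) i) = (\<Sum>j<n. G $$ (i, j) * (\<Sum>l\<le>k. coeff (q k) l * w l j))"
      unfolding g_def sum_distrib_left by (subst sum.swap) (simp add: mult_ac)
    also have "\<dots> = (\<Sum>j<n. G $$ (i, j) * ((- \<sigma>) ^ k * (g ^^ k) (\<lambda>i. b $ i) j))"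
      by (intro sum.cong refl) (simp add: Suc.IH)
    also have "\<dots> = (- \<sigma>) ^ k * (g ^^ Suc k) (\<lambda>i. b $ i) i"
      by (simp add: g_def sum_distrib_left mult_ac)
    finally show ?case by simp
  qed
  have val: "(poly_of_mat (q k) A *\<^sub>v b) $ i = (- \<sigma>) ^ k * (g ^^ k) (\<lambda>i. b $ i) i" if "i < n" for i
  proof -
    have "(poly_of_mat (q k) A *\<^sub>v b) $ i = b $ i + (\<Sum>l<k. coeff (q k) (Suc l) * w (Suc l) i)"
      unfolding w_def by (rule poly_of_mat_mult_vec[OF A b deg q0 that])
    also have "\<dots> = (\<Sum>l\<le>k. coeff (q k) l * w l i)"
      using q0[of k] A b that unfolding sum.atMost_shift by (simp add: w_def poly_0_coeff_0)
    finally show ?thesis using F[OF that] by simp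
  qed
  have "gmres_residual A b k \<le> vec_l2_norm (poly_of_mat (q k) A *\<^sub>v b)"
    unfolding gmres_residual_def
    using deg q0 by (intro cINF_lower bdd_belowI2[where m = 0]) (auto simp: vec_l2_norm_def)
  also have "\<dots> = \<sigma> ^ k * sqrt (sqsum n ((g ^^ k) (\<lambda>i. b $ i)))"
  proof -
    have "dim_vec (poly_of_mat (q k) A *\<^sub>v b) = n" using A by (simp add: poly_of_mat_def)
    then have "vec_l2_norm (poly_of_mat (q k) A *\<^sub>v b) = sqrt (\<Sum>i<n. (\<sigma> ^ k)\<^sup>2 * (cmod ((g ^^ k) (\<lambda>i. b $ i) i))\<^sup>2)"
      using \<sigma> by (simp add: vec_l2_norm_def L2_set_def val norm_mult norm_power power_mult_distrib
          del: index_mult_mat_vec)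
    then show ?thesis using \<sigma> by (simp add: sum_distrib_left[symmetric] sqsum_def real_sqrt_mult)
  qed
  finally show ?thesis by (simp add: A_def g_def)
qed


section \<open>The function \<open>frak_e\<close> and the limit\<close>

lemma frak_e_eq:
  assumes "0 \<le> x"
  shows "frak_e (sqrt (1 + x)) = (8 * x\<^sup>2 + 36 * x + 27 - (9 + 8 * x) powr (3 / 2)) / (8 * (1 + x))"
  using assms by (simp add: frak_e_def Let_def)

lemma powr_three_halves_sq: "0 \<le> a \<Longrightarrow> (a powr (3 / 2))\<^sup>2 = a ^ 3" for a :: real
  by (cases "a = 0") (simp_all add: power2_eq_square powr_add[symmetric])

text \<open>With \<open>x = \<eta>\<^sup>2 - 1\<close>, the squares of the two competing terms
  differ by \<open>64 * x ^ 3 * (1 + x)\<close>.\<close>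

lemma frak_e_pos:
  assumes "1 < \<eta>"
  shows "0 < frak_e \<eta>"
proof -
  define x where "x = \<eta>\<^sup>2 - 1"
  have x: "0 < x" and \<eta>: "\<eta> = sqrt (1 + x)" using assms by (simp_all add: x_def)
  have "((9 + 8 * x) powr (3 / 2))\<^sup>2 < (8 * x\<^sup>2 + 36 * x + 27)\<^sup>2"
  proof -
    have a: "0 < 9 + 8 * x" using x by simp
    have "0 < x * x * x * 64 + x * x * x * x * 64" using x by (intro add_pos_pos) simp_all
    then show ?thesis
      unfolding powr_three_halves_sq[OF less_imp_le[OF a]] by (simp add: power2_eq_square power3_eq_cube algebra_simps)
  qed
  then have "(9 + 8 * x) powr (3 / 2) < 8 * x\<^sup>2 + 36 * x + 27"
    by (rule power_less_imp_less_base) (use x in simp)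
  then show ?thesis using x unfolding \<eta> by (simp add: frak_e_eq)
qed

text \<open>The fractional power absorbs the terms \<open>36 * x + 27\<close>, since the squares
  differ by \<open>x\<^sup>2 * (432 + 512 * x)\<close>; only \<open>8 * x\<^sup>2\<close> survives
  in the numerator.\<close>

lemma frak_e_le:
  assumes "0 \<le> x"
  shows "frak_e (sqrt (1 + x)) \<le> x\<^sup>2 / (1 + x)"
proof -
  have "36 * x + 27 \<le> (9 + 8 * x) powr (3 / 2)"
  proof (rule power2_le_imp_le)
    have "0 \<le> x * x * (432 + 512 * x)" using assms by simp
    moreover have a: "0 \<le> 9 + 8 * x" using assms by simp
    ultimately show "(36 * x + 27)\<^sup>2 \<le> ((9 + 8 * x) powr (3 / 2))\<^sup>2"
      unfolding powr_three_halves_sq[OF a] by (simp add: power2_eq_square power3_eq_cube algebra_simps)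
  qed simp
  then have "frak_e (sqrt (1 + x)) \<le> (8 * x\<^sup>2) / (8 * (1 + x))"
    unfolding frak_e_eq[OF assms] using assms by (intro divide_right_mono) auto
  then show ?thesis by (simp only: mult_divide_mult_cancel_left_if) simp
qed

lemma Bernoulli_second_order:
  fixes v :: real
  assumes "0 \<le> v"
  shows "1 + real m * v + real m * (real m - 1) / 2 * v\<^sup>2 \<le> (1 + v) ^ m"
proof (induction m)
  case (Suc m)
  have "0 \<le> real m * (real m - 1) / 2 * v\<^sup>2 * v" using assms by (cases m) auto
  then have "1 + real (Suc m) * v + real (Suc m) * (real (Suc m) - 1) / 2 * v\<^sup>2
      \<le> (1 + v) * (1 + real m * v + real m * (real m - 1) / 2 * v\<^sup>2)"
    by (simp add: field_simps power2_eq_square)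
  also have "\<dots> \<le> (1 + v) * (1 + v) ^ m" using assms by (intro mult_left_mono Suc) auto
  finally show ?case by simp
qed simp

text \<open>Put \<open>v = \<eta> - 1\<close>. The second-order Bernoulli bound for exponent
  \<open>k + 2\<close> exceeds the left side by
  \<open>(1 - k v / 2)\<^sup>2 + k (k + 2) v\<^sup>2 / 4\<close>.\<close>

lemma Suc_mult_sq_minus_one_le:
  fixes \<eta> :: real
  assumes "1 \<le> \<eta>"
  shows "real (Suc k) * (\<eta>\<^sup>2 - 1) \<le> \<eta> ^ (k + 2)"
proof -
  define v where "v = \<eta> - 1"
  have v: "0 \<le> v" "\<eta> = 1 + v" using assms by (simp_all add: v_def)
  have "0 \<le> (1 - real k * v / 2)\<^sup>2 + real k * (real k + 2) / 4 * v\<^sup>2" by simp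
  also have "\<dots> = 1 + real (k + 2) * v + real (k + 2) * (real (k + 2) - 1) / 2 * v\<^sup>2
      - real (Suc k) * (\<eta>\<^sup>2 - 1)"
    by (simp add: v(2) power2_eq_square field_simps)
  finally show ?thesis using Bernoulli_second_order[OF v(1), of "k + 2"] v(2) by simp
qed

lemma Suc_sq_frak_e_le:
  assumes \<eta>: "1 < \<eta>"
  shows "(real (Suc k))\<^sup>2 * frak_e \<eta> \<le> (\<eta> ^ Suc k)\<^sup>2"
proof -
  have "(real (Suc k) * (\<eta>\<^sup>2 - 1))\<^sup>2 \<le> (\<eta> ^ (k + 2))\<^sup>2"
    using \<eta> by (intro power_mono Suc_mult_sq_minus_one_le) auto
  also have "\<dots> = (\<eta> ^ Suc k)\<^sup>2 * \<eta>\<^sup>2"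
    by (simp add: power_mult_distrib[symmetric] mult_ac)
  finally have "(real (Suc k))\<^sup>2 * ((\<eta>\<^sup>2 - 1)\<^sup>2 / \<eta>\<^sup>2) \<le> (\<eta> ^ Suc k)\<^sup>2"
    using \<eta> by (simp add: power_mult_distrib pos_divide_le_eq del: power_Suc of_nat_Suc)
  moreover have "frak_e \<eta> \<le> (\<eta>\<^sup>2 - 1)\<^sup>2 / \<eta>\<^sup>2"
    using frak_e_le[of "\<eta>\<^sup>2 - 1"] \<eta> by simp
  ultimately show ?thesis
    by (meson mult_left_mono order_trans zero_le_power2)
qed

text \<open>Multiplied by \<open>\<sigma> ^ k\<close>, this puts every member of the first infimum
  above \<open>\<sigma> ^ k * (k + 1)\<close>.\<close>

lemma Suc_le_resolvent_bound:
  assumes "1 < \<eta>"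
  shows "real (Suc k) \<le> \<eta> ^ Suc k * frak_e \<eta> powr (- (1 / 2))"
proof -
  have e: "0 < frak_e \<eta>" using frak_e_pos[OF assms] .
  have "(real (Suc k) * sqrt (frak_e \<eta>))\<^sup>2 \<le> (\<eta> ^ Suc k)\<^sup>2"
    using Suc_sq_frak_e_le[OF assms, of k] e by (simp add: power_mult_distrib)
  then have "real (Suc k) * sqrt (frak_e \<eta>) \<le> \<eta> ^ Suc k"
    by (rule power2_le_imp_le) (use assms in simp)
  then show ?thesis
    using e by (simp add: powr_minus powr_half_sqrt pos_le_divide_eq flip: divide_inverse)
qed

lemma Suc_le_two_sqrt_two_pow: "real (Suc k) \<le> 2 * sqrt 2 ^ k"
proof (rule power2_le_imp_le)
  have "(Suc k)\<^sup>2 \<le> 4 * 2 ^ k"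
  proof (induction k)
    case (Suc k)
    show ?case
    proof (cases "k < 2")
      case True
      then show ?thesis by (auto simp: less_2_cases_iff power2_eq_square)
    next
      \<comment> \<open>From \<open>k = 2\<close> on, passing to the next index at most doubles the
        square, because \<open>2 (k + 1)\<^sup>2 - (k + 2)\<^sup>2 = k\<^sup>2 - 2\<close>.\<close>
      case False
      then have "2 * 2 \<le> k * k" by (intro mult_mono) auto
      then have "(Suc (Suc k))\<^sup>2 \<le> 2 * (Suc k)\<^sup>2" by (simp add: power2_eq_square)
      then show ?thesis using Suc by simp
    qed
  qed simp
  then have "real ((Suc k)\<^sup>2) \<le> real (4 * 2 ^ k)" by (rule of_nat_mono)
  then show "(real (Suc k))\<^sup>2 \<le> (2 * sqrt 2 ^ k)\<^sup>2"
    by (simp add: power_mult_distrib power2_eq_square[of "sqrt 2 ^ k"] flip: power_mult_distrib)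
qed simp

section \<open>The almost sure limit\<close>

lemma excess_tendsto_0:
  assumes "s \<longlonglongrightarrow> 1" "\<tau> \<longlonglongrightarrow> 0"
  shows "(\<lambda>n. excess (s n) (\<tau> n) k) \<longlonglongrightarrow> 0"
proof (induction k)
  case (Suc k)
  have "(\<lambda>n. 2 * s n * excess (s n) (\<tau> n) k + \<tau> n * (real k * s n ^ (k - 1)))
      \<longlonglongrightarrow> 2 * 1 * 0 + 0 * (real k * 1 ^ (k - 1))"
    by (intro tendsto_intros assms Suc)
  then show ?case by simp
qed simp

text \<open>Repeated squaring produces moments of order a power of two; this finds one between
  \<open>sqrt N\<close> and \<open>2 * sqrt N\<close>.\<close>

lemma exists_pow2_between:
  fixes N :: nat
  assumes "1 \<le> N"
  shows "\<exists>s::nat. N < (2 ^ Suc s)\<^sup>2 \<and> (2 ^ Suc s)\<^sup>2 \<le> 4 * N"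
proof -
  obtain s where s: "4 ^ s \<le> N" "N < 4 ^ (s + 1)"
    using ex_power_ivl1[of 4 N] assms by auto
  have "(2 ^ Suc s)\<^sup>2 = (4 ^ Suc s :: nat)"
    by (simp add: power_mult[symmetric] mult.commute[of _ 2] flip: power_Suc) (simp add: power_mult)
  then show ?thesis using s by (intro exI[of _ s]) simp
qed

theorem gmres_residual_lesssim:
  fixes M :: "'w measure"
  assumes M: "prob_space M" and XY: "gaussian_arrays M X Y" and \<sigma>: "0 < \<sigma>" "\<sigma> < 1"
    and b: "\<And>N \<omega>. N \<ge> 1 \<Longrightarrow> \<omega> \<in> space M \<Longrightarrow> b N \<omega> \<in> carrier_vec N"
    and c: "\<sigma> ^ k * real (Suc k) \<le> c"
  shows "lesssim_almost_surely M
           (\<lambda>N \<omega>. gmres_residual (1\<^sub>m N + complex_of_real \<sigma> \<cdot>\<^sub>m ginibre X Y N \<omega>) (b N \<omega>) k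
                   / vec_l2_norm (b N \<omega>)) c"
  unfolding lesssim_almost_surely_def
proof (intro allI impI)
  fix \<epsilon> :: real assume \<epsilon>: "0 < \<epsilon>"
  interpret prob_space M by (rule M)
  define Z where "Z = (\<lambda>(first, i, j). if first then X i j else Y i j)"
  have Z: "indep_vars (\<lambda>_. borel) Z UNIV" "distributed M lborel (Z p) std_normal_density" for p
    using XY by (auto simp: gaussian_arrays_def Z_def split: prod.split)
  obtain s :: "nat \<Rightarrow> nat" where s: "\<And>N. 1 \<le> N \<Longrightarrow> N < (2 ^ Suc (s N))\<^sup>2" "\<And>N. 1 \<le> N \<Longrightarrow> (2 ^ Suc (s N))\<^sup>2 \<le> 4 * N"
    using exists_pow2_between by metis
  define n :: "nat \<Rightarrow> nat" where "n N = 2 ^ Suc (s N)" for N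
  \<comment> \<open>Just above the degree \<open>2 * k * n N\<close> reached by the moment. With
    \<open>n N\<close> of order \<open>sqrt N\<close>, \<open>D N / N\<close> tends to 0 while the
    moment still beats the dimension factor \<open>N\<close>.\<close>
  define D where "D N = 2 * k * n N + 1" for N
  have loc: "gaussian_fock N M Z" if "1 \<le> N" for N
    using that Z by unfold_locales auto
  define g where "g N = fock_space.gain N (D N) k" for N
  \<comment> \<open>Two margins above \<open>k + 1\<close>: \<open>gain\<close> eventually stays
    below the smaller \<open>\<kappa>'\<close>, and Markov's inequality is applied at
    \<open>\<kappa>\<close>. The ratio below 1 gives geometric decay.\<close>
  define \<kappa> where "\<kappa> = real (Suc k) + \<epsilon> / 2"
  define \<kappa>' where "\<kappa>' = real (Suc k) + \<epsilon> / 4"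
  have \<kappa>: "0 < \<kappa>'" "\<kappa>' < \<kappa>" "0 < \<kappa>" using \<epsilon> by (auto simp: \<kappa>_def \<kappa>'_def)
  have n_bounds: "sqrt N \<le> n N" "n N \<le> 2 * sqrt N" if "1 \<le> N" for N
  proof -
    have "real N \<le> (real (n N))\<^sup>2" "(real (n N))\<^sup>2 \<le> 4 * real N"
      using of_nat_mono[OF less_imp_le[OF s(1)[OF that]], where 'a = real]
        of_nat_mono[OF s(2)[OF that], where 'a = real] by (simp_all add: n_def)
    then show "sqrt N \<le> n N" "n N \<le> 2 * sqrt N"
      using real_le_lsqrt[of "n N" N] power2_le_imp_le[of "n N" "2 * sqrt N"] by (simp_all add: power_mult_distrib)
  qed
  have "(\<lambda>N. D N / N) \<longlonglongrightarrow> 0"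
  proof (rule tendsto_sandwich[OF _ _ tendsto_const])
    show "eventually (\<lambda>N. 0 \<le> D N / N) sequentially" by simp
    show "eventually (\<lambda>N. D N / N \<le> (4 * real k * sqrt N + 1) / N) sequentially"
      using eventually_ge_at_top[of 1]
    proof eventually_elim
      case (elim N)
      have "2 * real k * real (n N) \<le> 2 * real k * (2 * sqrt N)"
        using n_bounds(2)[OF elim] by (intro mult_left_mono) auto
      then show ?case by (intro divide_right_mono) (simp_all add: D_def)
    qed
    show "(\<lambda>N. (4 * real k * sqrt (real N) + 1) / N) \<longlonglongrightarrow> 0" by real_asymp
  qed
  note DN = this
  have sN: "(\<lambda>N. sqrt (1 + D N / N)) \<longlonglongrightarrow> 1"
    using tendsto_real_sqrt[OF tendsto_add[OF tendsto_const[of 1] DN]] by simp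
  have "(\<lambda>N. (real k + 1) * sqrt (1 + D N / N) ^ k + excess (sqrt (1 + D N / N)) (D N / N) k)
      \<longlonglongrightarrow> (real k + 1) * 1 ^ k + 0"
    by (intro tendsto_intros sN excess_tendsto_0 DN)
  then have lim: "(\<lambda>N. (real k + 1) * sqrt (1 + D N / N) ^ k + excess (sqrt (1 + D N / N)) (D N / N) k)
      \<longlonglongrightarrow> real (Suc k)"
    by (simp add: add.commute)
  have "real (Suc k) < \<kappa>'" using \<epsilon> by (simp add: \<kappa>'_def)
  from order_tendstoD(2)[OF lim this]
  have g_ev: "eventually (\<lambda>N. g N \<le> \<kappa>') sequentially"
    using eventually_ge_at_top[of 1]
  proof eventually_elim
    case (elim N)
    interpret gaussian_fock N "D N" M Z using loc elim by simp
    show ?case using elim by (simp add: g_def gain_def)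
  qed
  have "\<exists>A\<in>events. (1 \<le> N \<longrightarrow> prob A \<le> real N * (g N / \<kappa>) ^ (2 * n N)
      \<and> (\<forall>\<omega>\<in>space M - A. gmres_residual (1\<^sub>m N + complex_of_real \<sigma> \<cdot>\<^sub>m ginibre X Y N \<omega>) (b N \<omega>) k
            / vec_l2_norm (b N \<omega>) \<le> \<sigma> ^ k * \<kappa>))" for N
  proof (cases "1 \<le> N")
    case True
    interpret gaussian_fock N "D N" M Z using loc True by simp
    obtain A where A: "A \<in> events" "prob A \<le> real N * (g N / \<kappa>) ^ (2 * n N)"
      "\<And>\<omega> v. \<omega> \<in> space M - A \<Longrightarrow> sqsum N ((act True \<omega> ^^ k) v) \<le> \<kappa>\<^sup>2 * sqsum N v"
      using act_pow_bound_except[OF \<kappa>(3), of k "s N"] by (auto simp: D_def n_def g_def)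
    have "gmres_residual (1\<^sub>m N + complex_of_real \<sigma> \<cdot>\<^sub>m ginibre X Y N \<omega>) (b N \<omega>) k
        / vec_l2_norm (b N \<omega>) \<le> \<sigma> ^ k * \<kappa>" if \<omega>: "\<omega> \<in> space M - A" for \<omega>
    proof -
      define G where "G = ginibre X Y N \<omega>"
      define v where "v = (\<lambda>i. b N \<omega> $ i)"
      have G: "G \<in> carrier_mat N N" by (simp add: G_def ginibre_def)
      have bc: "b N \<omega> \<in> carrier_vec N" using b[OF True] \<omega> by simp
      have ent: "G $$ (i, j) = entry True \<omega> i j" if "i < N" "j < N" for i j
        unfolding entry_def G_def ginibre_def using that
        by (simp add: Z_def site_of_def phase_def real_sqrt_mult)
      have pow: "((\<lambda>v i. \<Sum>j<N. G $$ (i, j) * v j) ^^ l) v i = (act True \<omega> ^^ l) v i" if "i < N" for i l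
        using that by (induction l arbitrary: i) (simp_all add: act_def ent)
      have nrm: "vec_l2_norm (b N \<omega>) = sqrt (sqsum N v)"
        using bc by (simp add: vec_l2_norm_def L2_set_def sqsum_def v_def)
      have "gmres_residual (1\<^sub>m N + complex_of_real \<sigma> \<cdot>\<^sub>m G) (b N \<omega>) k
          \<le> \<sigma> ^ k * sqrt (sqsum N ((act True \<omega> ^^ k) v))"
        using gmres_residual_le_pow[OF G bc, of \<sigma> k] \<sigma> by (simp add: pow sqsum_def v_def[symmetric])
      also have "\<dots> \<le> \<sigma> ^ k * sqrt (\<kappa>\<^sup>2 * sqsum N v)"
        using A(3)[OF \<omega>] \<sigma> by (intro mult_left_mono) auto
      also have "\<dots> = \<sigma> ^ k * \<kappa> * vec_l2_norm (b N \<omega>)"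
        using \<kappa> by (simp add: nrm real_sqrt_mult)
      finally have le: "gmres_residual (1\<^sub>m N + complex_of_real \<sigma> \<cdot>\<^sub>m G) (b N \<omega>) k
          \<le> \<sigma> ^ k * \<kappa> * vec_l2_norm (b N \<omega>)" .
      show ?thesis
      \<comment> \<open>A quotient with denominator 0 has the value 0.\<close>
      proof (cases "vec_l2_norm (b N \<omega>) = 0")
        case True
        then show ?thesis using \<sigma> \<kappa> by simp
      next
        case False
        then have "0 < vec_l2_norm (b N \<omega>)" by (simp add: nrm less_le)
        then show ?thesis using le unfolding G_def by (rule mult_imp_div_pos_le)
      qed
    qed
    then show ?thesis using A by blast
  qed auto
  then obtain A where A: "\<And>N. A N \<in> events" "\<And>N. 1 \<le> N \<Longrightarrow> prob (A N) \<le> real N * (g N / \<kappa>) ^ (2 * n N)"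
    "\<And>N \<omega>. 1 \<le> N \<Longrightarrow> \<omega> \<in> space M - A N \<Longrightarrow>
      gmres_residual (1\<^sub>m N + complex_of_real \<sigma> \<cdot>\<^sub>m ginibre X Y N \<omega>) (b N \<omega>) k
            / vec_l2_norm (b N \<omega>) \<le> \<sigma> ^ k * \<kappa>"
    by metis
  define d where "d = - ln (\<kappa>' / \<kappa>)"
  have d: "0 < d" "\<kappa>' / \<kappa> = exp (- d)" using \<kappa> by (simp_all add: d_def ln_less_zero)
  have "summable (\<lambda>N. prob (A N))"
  proof (rule summable_comparison_test_ev)
    \<comment> \<open>Since \<open>n N\<close> is at least \<open>sqrt N\<close>, the failure
      probabilities decay like \<open>N * exp (- 2 * d * sqrt N)\<close>, hence are
      summable.\<close>
    have "eventually (\<lambda>N. real N * exp (- 2 * d * sqrt (real N)) \<le> 1 / real N ^ 2) sequentially"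
      using d(1) by real_asymp
    then show "eventually (\<lambda>N. norm (prob (A N)) \<le> 1 / real N ^ 2) sequentially"
      using g_ev eventually_ge_at_top[of 1]
    proof eventually_elim
      case (elim N)
      interpret gaussian_fock N "D N" M Z using loc elim by simp
      have "prob (A N) \<le> real N * (g N / \<kappa>) ^ (2 * n N)" using A(2) elim by simp
      also have "\<dots> \<le> real N * (\<kappa>' / \<kappa>) ^ (2 * n N)"
        using elim \<kappa> gain_nonneg[of k]
        by (intro mult_left_mono power_mono divide_right_mono) (auto simp: g_def)
      also have "\<dots> = real N * exp (- 2 * d * n N)"
        unfolding d(2) by (simp add: exp_of_nat_mult[symmetric] mult_ac)
      also have "\<dots> \<le> real N * exp (- 2 * d * sqrt N)"
        using n_bounds(1) elim d(1) by (intro mult_left_mono) auto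
      finally show ?case using elim by simp
    qed
    show "summable (\<lambda>N. 1 / real N ^ 2)" using inverse_power_summable[of 2] by (simp add: field_simps)
  qed
  then have "AE \<omega> in M. eventually (\<lambda>N. \<omega> \<in> space M - A N) sequentially"
    using A(1) by (intro borel_cantelli_AE1) (auto simp: emeasure_eq_measure)
  then show "AE \<omega> in M. (\<lambda>N. indicator {\<omega>. gmres_residual (1\<^sub>m N + complex_of_real \<sigma> \<cdot>\<^sub>m ginibre X Y N \<omega>) (b N \<omega>) k
                   / vec_l2_norm (b N \<omega>) < c + \<epsilon>} \<omega> :: real) \<longlonglongrightarrow> 1"
  proof eventually_elim
    case (elim \<omega>)
    have "\<sigma> ^ k * \<kappa> < c + \<epsilon>"
    proof -
      \<comment> \<open>As \<open>\<sigma> < 1\<close>, the margin \<open>\<epsilon> / 2\<close> in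
        \<open>\<kappa>\<close> does not grow under the factor \<open>\<sigma> ^ k\<close>.\<close>
      have "\<sigma> ^ k * (\<epsilon> / 2) \<le> 1 * (\<epsilon> / 2)"
        using \<sigma> \<epsilon> by (intro mult_right_mono power_le_one) auto
      moreover have "\<sigma> ^ k * \<kappa> = \<sigma> ^ k * real (Suc k) + \<sigma> ^ k * (\<epsilon> / 2)"
        unfolding \<kappa>_def by (rule distrib_left)
      ultimately show ?thesis using c \<epsilon> by linarith
    qed
    have "eventually (\<lambda>N. indicator {\<omega>. gmres_residual (1\<^sub>m N + complex_of_real \<sigma> \<cdot>\<^sub>m ginibre X Y N \<omega>) (b N \<omega>) k
                   / vec_l2_norm (b N \<omega>) < c + \<epsilon>} \<omega> = (1 :: real)) sequentially"
      using elim eventually_ge_at_top[of 1]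
    proof eventually_elim
      case (elim N)
      then show ?case using A(3)[of N \<omega>] \<open>\<sigma> ^ k * \<kappa> < c + \<epsilon>\<close> by simp
    qed
    then show ?case by (rule tendsto_eventually)
  qed
qed

theorem theorem3p4:
  fixes M :: "'w measure"
    and X Y :: "nat \<Rightarrow> nat \<Rightarrow> 'w \<Rightarrow> real"
    and b :: "nat \<Rightarrow> 'w \<Rightarrow> complex vec"
    and \<sigma> :: real and k :: nat
  assumes "prob_space M"
    and "gaussian_arrays M X Y"
    and "0 < \<sigma>" and "\<sigma> < 1"
    and "\<And>N \<omega>. N \<ge> 1 \<Longrightarrow> \<omega> \<in> space M \<Longrightarrow> b N \<omega> \<in> carrier_vec N"
    and "\<And>N i. N \<ge> 1 \<Longrightarrow> i < N \<Longrightarrow> (\<lambda>\<omega>. b N \<omega> $ i) \<in> borel_measurable M"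
    and "\<And>N. N \<ge> 1 \<Longrightarrow> AE \<omega> in M. b N \<omega> \<noteq> 0\<^sub>v N"
  shows "lesssim_almost_surely M
           (\<lambda>N \<omega>. gmres_residual (1\<^sub>m N + complex_of_real \<sigma> \<cdot>\<^sub>m ginibre X Y N \<omega>) (b N \<omega>) k
                   / vec_l2_norm (b N \<omega>))
           (INF \<eta>\<in>{1<..}. \<eta> * frak_e \<eta> powr (- (1 / 2)) * (\<sigma> * \<eta>) ^ k)
       \<and> lesssim_almost_surely M
           (\<lambda>N \<omega>. gmres_residual (1\<^sub>m N + complex_of_real \<sigma> \<cdot>\<^sub>m ginibre X Y N \<omega>) (b N \<omega>) k
                   / vec_l2_norm (b N \<omega>))
           (2 * (sqrt 2 * \<sigma>) ^ k)"
proof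
  \<comment> \<open>The bound holds for each \<open>\<eta> > 1\<close> separately and so passes to
    the infimum.\<close>
  have "\<sigma> ^ k * real (Suc k) \<le> (INF \<eta>\<in>{1<..}. \<eta> * frak_e \<eta> powr (- (1 / 2)) * (\<sigma> * \<eta>) ^ k)"
  proof (rule cINF_greatest)
    fix \<eta> :: real assume "\<eta> \<in> {1<..}"
    then have "\<sigma> ^ k * real (Suc k) \<le> \<sigma> ^ k * (\<eta> ^ Suc k * frak_e \<eta> powr (- (1 / 2)))"
      using assms(3) by (intro mult_left_mono Suc_le_resolvent_bound) auto
    then show "\<sigma> ^ k * real (Suc k) \<le> \<eta> * frak_e \<eta> powr (- (1 / 2)) * (\<sigma> * \<eta>) ^ k"
      by (simp add: power_mult_distrib mult_ac)
  qed (use gt_ex in auto)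
  then show "lesssim_almost_surely M
           (\<lambda>N \<omega>. gmres_residual (1\<^sub>m N + complex_of_real \<sigma> \<cdot>\<^sub>m ginibre X Y N \<omega>) (b N \<omega>) k
                   / vec_l2_norm (b N \<omega>))
           (INF \<eta>\<in>{1<..}. \<eta> * frak_e \<eta> powr (- (1 / 2)) * (\<sigma> * \<eta>) ^ k)"
    by (intro gmres_residual_lesssim assms(1-5))
  have "\<sigma> ^ k * real (Suc k) \<le> \<sigma> ^ k * (2 * sqrt 2 ^ k)"
    using assms(3) by (intro mult_left_mono Suc_le_two_sqrt_two_pow) auto
  then have "\<sigma> ^ k * real (Suc k) \<le> 2 * (sqrt 2 * \<sigma>) ^ k"
    by (simp add: power_mult_distrib mult_ac)
  then show "lesssim_almost_surely M
           (\<lambda>N \<omega>. gmres_residual (1\<^sub>m N + complex_of_real \<sigma> \<cdot>\<^sub>m ginibre X Y N \<omega>) (b N \<omega>) k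
                   / vec_l2_norm (b N \<omega>))
           (2 * (sqrt 2 * \<sigma>) ^ k)"
    by (intro gmres_residual_lesssim assms(1-5))
qed

end
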